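(* Let $H=(V,F)$ be a finite hypergraph with directed edges $\vec E$ and relation $\rightharpoonup$ as in the context. Fix positive integers $(r_i)_{i\in V}$ and, for every $\alpha\in F$ and distinct $i,j\in\alpha$, a matrix $u^\alpha_{i\to j}\in\mathbb{C}^{r_j\times r_i}$. For $e\in\vec E$ put $r_e=r_{t(e)}$, and for $e'\rightharpoonup e$ put $w_{e'\rightharpoonup e}=u^{s(e)}_{t(e')\to t(e)}$; let $\zeta_H(\mathbf u)$ denote the graph zeta function with these weights. For $\alpha\in F$ let $U_\alpha$ be the block matrix indexed by $\alpha\times\alpha$ whose $(i,i)$ block is $I_{r_i}$ and whose $(i,j)$ block ($i\ne j$) is $u^\alpha_{j\to i}$; assume each $U_\alpha$ is invertible and write $W_\alpha=U_\alpha^{-1}$, denoting its $(i,j)$ block by $w^\alpha_{j\to i}$. Define linear maps $\mathcal D,\mathcal W$ on $\bigoplus_{i\in V}\mathbb{C}^{r_i}$ by $(\mathcal D g)(i)=d_i\,g(i)$ and $(\mathcal W g)(i)=\sum_{\alpha\ni i}\sum_{j\in\alpha}w^\alpha_{j\to i}\,g(j)$. Then $$\zeta_H(\mathbf u)^{-1}=\det\big(I_{r_V}-\mathcal D+\mathcal W\big)\prod_{\alpha\in F}\det U_\alpha,\qquad r_V=\sum_{i\in V}r_i.$$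
   Context: A hypergraph $H=(V,F)$: finite vertex set $V$, finite collection $F$ of nonempty subsets of $V$ (factors); $d_i=|\{\alpha\in F:i\in\alpha\}|$. Directed edges $\vec E=\{(\alpha\to i):\alpha\in F,i\in\alpha\}$, $s(\alpha\to i)=\alpha$, $t(\alpha\to i)=i$. For $e,e'\in\vec E$, $e\rightharpoonup e'$ means $t(e)\in s(e')$, $t(e)\ne t(e')$ and $s(e)\ne s(e')$. Closed geodesics are sequences $(e_1,\dots,e_k)$ with $e_l\rightharpoonup e_{l+1}$ for $l\in\mathbb{Z}/k\mathbb{Z}$; prime cycles $\mathfrak p$ are cyclic-equivalence classes of closed geodesics that are not repetitions of shorter ones. With weights $w_{e\rightharpoonup e'}\in\mathbb{C}^{r_{e'}\times r_e}$ set $\pi(\mathfrak p)=w_{e_k\rightharpoonup e_1}\cdots w_{e_1\rightharpoonup e_2}$ and $\zeta_H=\prod_{\mathfrak p}\det(I-\pi(\mathfrak p))^{-1}$, understood for arbitrary weights via its continuation $\zeta_H^{-1}=\det(I-\mathcal M)$, where $(\mathcal Mf)(e')=\sum_{e:e\rightharpoonup e'}w_{e\rightharpoonup e'}f(e)$ on $\bigoplus_{e}\mathbb{C}^{r_e}$. *)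

theory Defs
  imports "HOL-Complex_Analysis.Complex_Analysis" "Jordan_Normal_Form.Determinant"
begin

section \<open>Hypergraphs, closed geodesics and prime cycles\<close>

definition hypergraph :: "'v set \<Rightarrow> 'v set set \<Rightarrow> bool" where
  "hypergraph V F \<longleftrightarrow> finite V \<and> finite F \<and> (\<forall>\<alpha>\<in>F. \<alpha> \<noteq> {} \<and> \<alpha> \<subseteq> V)"

definition vertex_degree :: "'v set set \<Rightarrow> 'v \<Rightarrow> nat" where
  "vertex_degree F i = card {\<alpha> \<in> F. i \<in> \<alpha>}"

text \<open>The directed edge from the factor \<open>\<alpha>\<close> to the vertex \<open>i \<in> \<alpha>\<close> is the pair \<open>(\<alpha>, i)\<close>.\<close>

type_synonym 'v dedge = "'v set \<times> 'v"

abbreviation edge_source :: "'v dedge \<Rightarrow> 'v set" where "edge_source \<equiv> fst"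
abbreviation edge_target :: "'v dedge \<Rightarrow> 'v" where "edge_target \<equiv> snd"

definition dedges :: "'v set set \<Rightarrow> 'v dedge set" where
  "dedges F = (SIGMA \<alpha>:F. \<alpha>)"

definition follows :: "'v dedge \<Rightarrow> 'v dedge \<Rightarrow> bool" (infix "\<rightharpoonup>" 50) where
  "e \<rightharpoonup> e' \<longleftrightarrow> edge_target e \<in> edge_source e' \<and>
     edge_target e \<noteq> edge_target e' \<and> edge_source e \<noteq> edge_source e'"

definition closed_geodesics :: "'v set set \<Rightarrow> 'v dedge list set" where
  "closed_geodesics F = {c. c \<noteq> [] \<and> set c \<subseteq> dedges F \<and>
     (\<forall>l<length c. c ! l \<rightharpoonup> c ! (Suc l mod length c))}"

definition prime_geodesics :: "'v set set \<Rightarrow> 'v dedge list set" where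
  "prime_geodesics F = {c \<in> closed_geodesics F.
     \<not> (\<exists>d m. m \<ge> 2 \<and> c = concat (replicate m d))}"

definition prime_cycles :: "'v set set \<Rightarrow> 'v dedge list set set" where
  "prime_cycles F =
     prime_geodesics F // {(c, d). c \<in> prime_geodesics F \<and> (\<exists>n. d = rotate n c)}"


section \<open>The zeta function\<close>

text \<open>
  A weight family assigns to \<open>e \<rightharpoonup> e'\<close> a matrix \<open>w e e'\<close> with \<open>r e'\<close> rows and \<open>r e\<close> columns.
  For \<open>c = [e\<^sub>1, \<dots>, e\<^sub>k]\<close> the following is the product
  \<open>w e\<^sub>k e\<^sub>1 * w e\<^bsub>k-1\<^esub> e\<^sub>k * \<dots> * w e\<^sub>1 e\<^sub>2\<close>, the rightmost factor being applied first.
\<close>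

definition geodesic_weight ::
    "('v dedge \<Rightarrow> nat) \<Rightarrow> ('v dedge \<Rightarrow> 'v dedge \<Rightarrow> complex mat) \<Rightarrow> 'v dedge list \<Rightarrow> complex mat" where
  "geodesic_weight r w c =
     fold (\<lambda>l P. w (c ! l) (c ! (Suc l mod length c)) * P) [0..<length c] (1\<^sub>m (r (hd c)))"

text \<open>\<open>det (I - \<pi>(\<pp>))\<close>; it does not depend on the chosen representative of the cycle.\<close>

definition cycle_det ::
    "('v dedge \<Rightarrow> nat) \<Rightarrow> ('v dedge \<Rightarrow> 'v dedge \<Rightarrow> complex mat) \<Rightarrow> 'v dedge list set \<Rightarrow> complex" where
  "cycle_det r w \<pp> =
     (let c = (SOME c. c \<in> \<pp>) in Determinant.det (1\<^sub>m (r (hd c)) - geodesic_weight r w c))"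

definition has_euler_product ::
    "'v set set \<Rightarrow> ('v dedge \<Rightarrow> nat) \<Rightarrow> ('v dedge \<Rightarrow> 'v dedge \<Rightarrow> complex mat) \<Rightarrow> complex \<Rightarrow> bool" where
  "has_euler_product F r w z \<longleftrightarrow>
     ((\<lambda>P. \<Prod>\<pp>\<in>P. inverse (cycle_det r w \<pp>)) \<longlongrightarrow> z) (finite_subsets_at_top (prime_cycles F))"

text \<open>
  The Euler product converges (unconditionally) only for small weights.  For arbitrary weights \<open>w\<close>
  the zeta function is its analytic continuation along the ray of weights \<open>s w\<close>, from small \<open>s\<close>
  to \<open>s = 1\<close>: the reciprocal extends to an entire function \<open>g\<close> of \<open>s\<close>, unique by the identity
  theorem and in fact equal to \<open>det (I - s \<M>)\<close> for
  \<open>(\<M> f)(e') = (\<Sum>e | e \<rightharpoonup> e'. w e e' (f e))\<close>, and the value of zeta is \<open>1 / g 1\<close>.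
  At a pole (\<open>g 1 = 0\<close>) the convention \<open>inverse 0 = 0\<close> applies, so that the reciprocal
  of zeta is \<open>g 1\<close> in all cases.
\<close>

definition graph_zeta ::
    "'v set set \<Rightarrow> ('v dedge \<Rightarrow> nat) \<Rightarrow> ('v dedge \<Rightarrow> 'v dedge \<Rightarrow> complex mat) \<Rightarrow> complex" where
  "graph_zeta F r w = inverse (THE z. \<exists>g. g holomorphic_on UNIV \<and>
     (\<exists>\<delta>>0. \<forall>s. norm s < \<delta> \<longrightarrow> g s \<noteq> 0 \<and>
        has_euler_product F r (\<lambda>e e'. s \<cdot>\<^sub>m w e e') (inverse (g s))) \<and>
     z = g 1)"


section \<open>Block matrices and operators on direct sums\<close>

text \<open>
  The direct sum of the spaces \<open>\<complex>\<^bsup>r x\<^esup>\<close>, \<open>x \<in> X\<close>, has coordinates \<open>(x, a)\<close> with \<open>a < r x\<close>.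
  Matrices over these coordinates use the enumeration \<open>from_nat_into\<close> of the coordinate set, a
  bijection from \<open>{..<card (coords X r)}\<close>.
\<close>

definition coords :: "'x set \<Rightarrow> ('x \<Rightarrow> nat) \<Rightarrow> ('x \<times> nat) set" where
  "coords X r = (SIGMA x:X. {..<r x})"

definition mat_on :: "'i set \<Rightarrow> ('i \<Rightarrow> 'i \<Rightarrow> complex) \<Rightarrow> complex mat" where
  "mat_on I A = Matrix.mat (card I) (card I)
     (\<lambda>(k, l). A (from_nat_into I k) (from_nat_into I l))"

definition block_mat ::
    "'x set \<Rightarrow> ('x \<Rightarrow> nat) \<Rightarrow> ('x \<Rightarrow> 'x \<Rightarrow> complex mat) \<Rightarrow> complex mat" where
  "block_mat X r B = mat_on (coords X r) (\<lambda>(x, a) (y, b). B x y $$ (a, b))"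

text \<open>Determinant of a linear map \<open>T\<close> on the functions on \<open>I\<close>, via its matrix in the
  standard basis.\<close>

definition op_det :: "'i set \<Rightarrow> (('i \<Rightarrow> complex) \<Rightarrow> ('i \<Rightarrow> complex)) \<Rightarrow> complex" where
  "op_det I T = Determinant.det (mat_on I (\<lambda>x y. T (\<lambda>z. if z = y then 1 else 0) x))"


section \<open>The objects of the determinant formula\<close>

text \<open>\<open>u \<alpha> i j\<close> stands for the matrix with sub- and superscripts
  \<open>u\<^sup>\<alpha>\<close>, \<open>i \<rightarrow> j\<close>, having \<open>r j\<close> rows and \<open>r i\<close> columns; likewise \<open>w \<alpha> i j\<close>.\<close>

definition edge_weights ::
    "('v set \<Rightarrow> 'v \<Rightarrow> 'v \<Rightarrow> complex mat) \<Rightarrow> 'v dedge \<Rightarrow> 'v dedge \<Rightarrow> complex mat" where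
  "edge_weights u e' e = u (edge_source e) (edge_target e') (edge_target e)"

definition U_mat ::
    "('v \<Rightarrow> nat) \<Rightarrow> ('v set \<Rightarrow> 'v \<Rightarrow> 'v \<Rightarrow> complex mat) \<Rightarrow> 'v set \<Rightarrow> complex mat" where
  "U_mat r u \<alpha> = block_mat \<alpha> r (\<lambda>i j. if i = j then 1\<^sub>m (r i) else u \<alpha> j i)"

definition W_mat ::
    "('v \<Rightarrow> nat) \<Rightarrow> ('v set \<Rightarrow> 'v \<Rightarrow> 'v \<Rightarrow> complex mat) \<Rightarrow> 'v set \<Rightarrow> complex mat" where
  "W_mat r w \<alpha> = block_mat \<alpha> r (\<lambda>i j. w \<alpha> j i)"

definition D_op :: "'v set set \<Rightarrow> ('v \<times> nat \<Rightarrow> complex) \<Rightarrow> 'v \<times> nat \<Rightarrow> complex" where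
  "D_op F g = (\<lambda>(i, a). of_nat (vertex_degree F i) * g (i, a))"

definition W_op ::
    "'v set set \<Rightarrow> ('v \<Rightarrow> nat) \<Rightarrow> ('v set \<Rightarrow> 'v \<Rightarrow> 'v \<Rightarrow> complex mat) \<Rightarrow>
     ('v \<times> nat \<Rightarrow> complex) \<Rightarrow> 'v \<times> nat \<Rightarrow> complex" where
  "W_op F r w g = (\<lambda>(i, a). \<Sum>\<alpha> | \<alpha> \<in> F \<and> i \<in> \<alpha>. \<Sum>j\<in>\<alpha>. \<Sum>b<r j. w \<alpha> j i $$ (a, b) * g (j, b))"

end

theory Submission
  imports Defs "Jordan_Normal_Form.Schur_Decomposition"
begin

text \<open>
  For small weights, \<open>- log det (I - \<M>) = (\<Sum>n\<ge>1. tr (\<M>\<^sup>n) / n)\<close> is a sum over closed geodesics.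
  Writing each closed geodesic as a power of a prime one and grouping by prime cycles turns it
  into the sum of \<open>- log det (I - \<pi>(\<pp>))\<close>, which gives the Euler product; by the identity
  theorem \<open>det (I - s \<M>)\<close> is then the only entire continuation of the reciprocal.
  For the determinant formula, let \<open>S\<close> sum a function on directed edges over the edges into a
  vertex, and let \<open>U\<close> be the block diagonal matrix of the \<open>U\<^sub>\<alpha>\<close>.  Then
  \<open>\<M> = (U - I) (S\<^sup>T S - I)\<close>, so \<open>I - \<M> = U (I - (I - U\<^sup>-\<^sup>1) S\<^sup>T S)\<close>, and
  Sylvester's identity moves \<open>S\<close> to the front: \<open>S S\<^sup>T = \<D>\<close> and \<open>S U\<^sup>-\<^sup>1 S\<^sup>T = \<W>\<close>.
\<close>

section \<open>Primitive words and prime cycles\<close>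

text \<open>No logarithm of a determinant is ever taken. What is carried through is an unconditional
  sum \<open>L\<close> with \<open>exp (- L)\<close> equal to the determinant; this involves no
  choice of branch, and exponentiating it turns an unconditional sum over prime cycles into an
  unconditional product. Summing over closed geodesics directly is awkward: \<open>tr (M^n)\<close>
  expands over all words of directed edges, while weights between edges that do not follow each
  other are arbitrary, even in size. With these replaced by zero matrices every word is admissible,
  and a word that is not a closed geodesic has trace 0. In the factorization of \<open>M\<close>,
  subtracting the identity from \<open>S^T S\<close> encodes that consecutive edges have different
  sources, and the zero diagonal blocks of \<open>U - I\<close> encode that they have different
  targets.\<close>

lemma length_concat_replicate [simp]: "length (concat (replicate m xs)) = m * length xs"
  by (induction m) auto

lemma nth_concat_replicate:
  "l < m * length xs \<Longrightarrow> concat (replicate m xs) ! l = xs ! (l mod length xs)"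
proof (induction m arbitrary: l)
  case (Suc m)
  then show ?case
    by (cases "l < length xs") (auto simp: nth_append le_mod_geq)
qed simp

lemma concat_replicate_concat_replicate:
  "concat (replicate m (concat (replicate n xs))) = concat (replicate (m * n) xs)"
  by (induction m) (auto simp: replicate_add)

lemma hd_concat_replicate: "m > 0 \<Longrightarrow> hd (concat (replicate m xs)) = hd xs"
  by (cases m; cases "xs = []") auto

definition primitive :: "'a list \<Rightarrow> bool" where
  "primitive xs \<longleftrightarrow> \<not> (\<exists>ys m. m \<ge> 2 \<and> xs = concat (replicate m ys))"

text \<open>The empty word is its own square, so the definition excludes it without a separate
  clause.\<close>

lemma primitive_neq_Nil: "primitive xs \<Longrightarrow> xs \<noteq> []"
  unfolding primitive_def by (metis concat_replicate_trivial order_refl)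

lemma primitive_root_exists:
  assumes "xs \<noteq> []"
  shows "\<exists>ys m. primitive ys \<and> m > 0 \<and> xs = concat (replicate m ys)"
  using assms
proof (induction "length xs" arbitrary: xs rule: less_induct)
  case less
  show ?case
  proof (cases "primitive xs")
    case True
    then have "primitive xs \<and> (1::nat) > 0 \<and> xs = concat (replicate 1 xs)" by simp
    then show ?thesis by blast
  next
    case False
    then obtain ys m where m: "m \<ge> 2" and xs: "xs = concat (replicate m ys)"
      unfolding primitive_def by blast
    with less.prems have "ys \<noteq> []" by auto
    moreover from this m have "length ys < length xs"
      unfolding xs length_concat_replicate by (cases m) auto
    ultimately obtain zs n where "primitive zs" "n > 0" "ys = concat (replicate n zs)"
      using less.hyps by blast
    with m xs show ?thesis
      by (intro exI[of _ zs] exI[of _ "m * n"]) (simp add: concat_replicate_concat_replicate)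
  qed
qed

text \<open>Commuting words are powers of a common word; primitivity forces both exponents to be
  1.\<close>

lemma primitive_commute_eq:
  assumes "primitive xs" "primitive ys" "xs @ ys = ys @ xs"
  shows "xs = ys"
proof -
  obtain m n zs where xs: "concat (replicate m zs) = xs" and ys: "concat (replicate n zs) = ys"
    using comm_append_are_replicate[OF assms(3)] by blast
  have "m = 1" if "primitive (concat (replicate m zs))" for m
  proof -
    have "\<not> m \<ge> 2" using that unfolding primitive_def by blast
    moreover have "m \<noteq> 0" using primitive_neq_Nil[OF that] by (intro notI) simp
    ultimately show "m = 1" by linarith
  qed
  with assms xs ys show ?thesis by metis
qed

text \<open>The common power \<open>w\<close> begins with either root, and removing a leading
  \<open>xs\<close> from \<open>w @ w\<close> leaves a word that begins with \<open>w\<close> again.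
  Hence \<open>w @ w\<close> begins with \<open>xs @ ys\<close> and, by symmetry, with
  \<open>ys @ xs\<close>, so the roots commute. Doubling \<open>w\<close> makes it long enough to
  contain both.\<close>

lemma primitive_root_unique:
  assumes "primitive xs" "primitive ys" "m > 0" "n > 0"
    and eq: "concat (replicate m xs) = concat (replicate n ys)"
  shows "xs = ys" and "m = n"
proof -
  define w where "w = concat (replicate m xs)"
  have prefix: "take (length xs + length ys) (w @ w) = xs @ ys"
    if "w = concat (replicate m xs)" "w = concat (replicate n ys)" "m > 0" "n > 0"
    for xs ys :: "'a list" and m n
  proof -
    from that obtain m' n' where "m = Suc m'" "n = Suc n'" by (meson gr0_conv_Suc)
    with that have ws: "w = xs @ concat (replicate m' xs)" "w = ys @ concat (replicate n' ys)"
      by simp_all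
    have "w @ xs = xs @ w"
      unfolding that(1) by (metis concat.simps(2) concat_append concat.simps(1) append_Nil2
          replicate_append_same replicate_Suc)
    have "w @ w = xs @ w @ concat (replicate m' xs)"
      using ws(1) \<open>w @ xs = xs @ w\<close> by (metis append.assoc)
    also have "\<dots> = (xs @ ys) @ concat (replicate n' ys) @ concat (replicate m' xs)"
      by (subst ws(2)) simp
    finally show ?thesis by simp
  qed
  have "xs @ ys = ys @ xs"
    using prefix[of m xs n ys] prefix[of n ys m xs] eq assms(3,4)
    by (simp add: w_def add.commute)
  then show "xs = ys" using primitive_commute_eq assms by blast
  with eq have "m * length xs = n * length xs" by (metis length_concat_replicate)
  with primitive_neq_Nil[OF assms(1)] show "m = n" by simp
qed

lemma rotate_concat_replicate:
  "rotate n (concat (replicate m xs)) = concat (replicate m (rotate n xs))"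
proof (cases "xs = [] \<or> m = 0")
  case False
  show ?thesis
  proof (rule nth_equalityI)
    fix l assume "l < length (rotate n (concat (replicate m xs)))"
    then have l: "l < m * length xs" by simp
    then have pos: "0 < m * length xs" by linarith
    have "rotate n (concat (replicate m xs)) ! l = xs ! ((n + l) mod length xs)"
      using l pos False by (simp add: nth_rotate nth_concat_replicate mod_mod_cancel)
    also have "\<dots> = concat (replicate m (rotate n xs)) ! l"
      using l False by (simp add: nth_rotate nth_concat_replicate mod_add_right_eq)
    finally show "rotate n (concat (replicate m xs)) ! l =
        concat (replicate m (rotate n xs)) ! l" .
  qed simp
qed auto

lemma rotate_inverse: "\<exists>k. rotate k (rotate n xs) = xs"
proof
  \<comment> \<open>The two rotations add up to \<open>n\<close> full turns; the subtraction on
    naturals is exact because a nonempty word has length at least 1.\<close>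
  show "rotate (length xs * n - n) (rotate n xs) = xs"
    by (cases "xs = []") (auto simp: rotate_rotate Suc_leI)
qed

lemma primitive_rotate [simp]: "primitive (rotate n xs) \<longleftrightarrow> primitive xs"
proof -
  have "primitive xs" if "primitive (rotate n xs)" for n and xs :: "'a list"
    using that unfolding primitive_def using rotate_concat_replicate by blast
  then show ?thesis by (metis rotate_inverse)
qed

text \<open>A rotation that fixes \<open>xs\<close> cuts it into two nonempty commuting pieces,
  which are then powers of one word, and so is \<open>xs\<close>.\<close>

lemma primitive_rotate_neq:
  assumes "primitive xs" "0 < n" "n < length xs"
  shows "rotate n xs \<noteq> xs"
proof
  assume "rotate n xs = xs"
  with assms have "drop n xs @ take n xs = xs" by (simp add: rotate_drop_take)
  then have "take n xs @ drop n xs = drop n xs @ take n xs" by simp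
  then obtain a b zs where zs: "concat (replicate a zs) = take n xs"
      "concat (replicate b zs) = drop n xs"
    using comm_append_are_replicate by blast
  have "a \<noteq> 0" using zs(1) assms by (intro notI) auto
  moreover have "b \<noteq> 0" using zs(2) assms by (intro notI) auto
  ultimately have "a + b \<ge> 2" by linarith
  moreover have "xs = concat (replicate (a + b) zs)"
    using zs by (simp add: replicate_add)
  ultimately show False using assms(1) unfolding primitive_def by blast
qed

lemma rotate_mod_length: "rotate n xs = rotate (n mod length xs) xs"
  by (simp add: rotate_drop_take)

text \<open>The cyclic group acts freely: if rotations by \<open>i < j\<close> agreed, the word
  rotated by \<open>i\<close>, which is again primitive, would be fixed by a further rotation by
  \<open>j - i\<close>.\<close>

lemma card_rotations:
  assumes "primitive xs"
  shows "card (range (\<lambda>n. rotate n xs)) = length xs"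
proof -
  have len: "length xs > 0" using primitive_neq_Nil[OF assms] by simp
  have "rotate i xs \<noteq> rotate j xs" if "i < j" "j < length xs" for i j
  proof -
    have "rotate j xs = rotate (j - i) (rotate i xs)" using that by (simp add: rotate_rotate)
    then show ?thesis
      using primitive_rotate_neq[of "rotate i xs" "j - i"] assms that
      by (metis length_rotate less_imp_diff_less primitive_rotate zero_less_diff)
  qed
  then have "inj_on (\<lambda>n. rotate n xs) {..<length xs}"
    by (intro linorder_inj_onI) auto
  moreover have "range (\<lambda>n. rotate n xs) = (\<lambda>n. rotate n xs) ` {..<length xs}"
    using len rotate_mod_length[of _ xs] by (fastforce simp: image_iff intro: mod_less_divisor)
  ultimately show ?thesis by (simp add: card_image)
qed

section \<open>Closed geodesics under rotations and powers\<close>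

lemma closed_geodesics_neq_Nil: "c \<in> closed_geodesics F \<Longrightarrow> c \<noteq> []"
  by (simp add: closed_geodesics_def)

lemma prime_geodesics_eq: "prime_geodesics F = {c \<in> closed_geodesics F. primitive c}"
  by (auto simp: prime_geodesics_def primitive_def)

lemma closed_geodesics_rotate:
  assumes "c \<in> closed_geodesics F" shows "rotate n c \<in> closed_geodesics F"
proof -
  have "rotate n c ! l \<rightharpoonup> rotate n c ! (Suc l mod length c)" if "l < length c" for l
  proof -
    have "rotate n c ! (Suc l mod length c) = c ! (Suc ((n + l) mod length c) mod length c)"
      using that by (subst nth_rotate) (auto simp: mod_simps intro!: mod_less_divisor)
    moreover have "(n + l) mod length c < length c"
      by (rule mod_less_divisor) (use that in linarith)
    ultimately show ?thesis
      using assms that by (auto simp: nth_rotate closed_geodesics_def)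
  qed
  with assms show ?thesis by (simp add: closed_geodesics_def)
qed

text \<open>Positions in the power are read modulo the length of \<open>c\<close>, and the passage
  from one copy to the next is the closing step of \<open>c\<close>. So both sides impose the same
  adjacency conditions, one of them \<open>m\<close> times over.\<close>

lemma closed_geodesics_power_iff:
  assumes "m > 0"
  shows "concat (replicate m c) \<in> closed_geodesics F \<longleftrightarrow> c \<in> closed_geodesics F"
proof (cases "c = []")
  case False
  define k where "k = length c"
  have k: "k > 0" using False by (simp add: k_def)
  have le: "k \<le> m * k" using assms by simp
  have *: "concat (replicate m c) ! l = c ! (l mod k)"
    "concat (replicate m c) ! (Suc l mod (m * k)) = c ! (Suc (l mod k) mod k)"
    if "l < m * k" for l
    using that k assms by (auto simp: nth_concat_replicate k_def mod_mod_cancel mod_Suc_eq)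
  have "(\<forall>l<m * k. concat (replicate m c) ! l \<rightharpoonup> concat (replicate m c) ! (Suc l mod (m * k)))
      \<longleftrightarrow> (\<forall>l<m * k. c ! (l mod k) \<rightharpoonup> c ! (Suc (l mod k) mod k))"
    using * by auto
  also have "\<dots> \<longleftrightarrow> (\<forall>l<k. c ! l \<rightharpoonup> c ! (Suc l mod k))"
    using k le by (metis mod_less mod_less_divisor order_less_le_trans)
  finally show ?thesis
    using False assms by (auto simp: closed_geodesics_def k_def set_concat)
qed (use assms in \<open>auto simp: closed_geodesics_def\<close>)

lemma bij_betw_prime_powers:
  "bij_betw (\<lambda>(c, m). concat (replicate m c)) (prime_geodesics F \<times> {0<..}) (closed_geodesics F)"
  unfolding bij_betw_def
proof
  show "inj_on (\<lambda>(c, m). concat (replicate m c)) (prime_geodesics F \<times> {0<..})"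
    using primitive_root_unique by (auto simp: inj_on_def prime_geodesics_eq) 
  show "(\<lambda>(c, m). concat (replicate m c)) ` (prime_geodesics F \<times> {0<..}) = closed_geodesics F"
    (is "?f ` ?A = _")
  proof (intro equalityI subsetI)
    fix c assume c: "c \<in> closed_geodesics F"
    then obtain d m where d: "primitive d" "m > 0" "c = concat (replicate m d)"
      using primitive_root_exists closed_geodesics_neq_Nil by blast
    with c have "d \<in> closed_geodesics F" by (simp add: closed_geodesics_power_iff)
    with d show "c \<in> ?f ` ?A" by (auto simp: prime_geodesics_eq intro!: rev_image_eqI[of "(d, m)"])
  qed (auto simp: prime_geodesics_eq closed_geodesics_power_iff)
qed

lemma prime_geodesics_rotate: "c \<in> prime_geodesics F \<Longrightarrow> rotate n c \<in> prime_geodesics F"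
  by (simp add: prime_geodesics_eq closed_geodesics_rotate)

lemma prime_cycles_eq: "prime_cycles F = (\<lambda>c. range (\<lambda>n. rotate n c)) ` prime_geodesics F"
  by (auto simp: prime_cycles_def quotient_def Image_def full_SetCompr_eq)

text \<open>\<open>cycle_det\<close> evaluates at an arbitrarily chosen representative, so any
  member must be known to generate the whole class; rotations being invertible, it does.\<close>

lemma prime_cycle_rotations:
  assumes "p \<in> prime_cycles F" "c \<in> p"
  shows "c \<in> prime_geodesics F" and "p = range (\<lambda>n. rotate n c)"
proof -
  obtain d n where d: "d \<in> prime_geodesics F" "p = range (\<lambda>n. rotate n d)" "c = rotate n d"
    using assms by (auto simp: prime_cycles_eq)
  show "c \<in> prime_geodesics F" using d by (simp add: prime_geodesics_rotate)
  obtain k where "rotate k c = d" using d rotate_inverse by metis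
  then have "rotate m d \<in> range (\<lambda>n. rotate n c)" for m
    by (metis rangeI rotate_rotate)
  then show "p = range (\<lambda>n. rotate n c)" using d by (auto simp: rotate_rotate)
qed

lemma prime_cycle_neq_empty: "p \<in> prime_cycles F \<Longrightarrow> p \<noteq> {}"
  by (auto simp: prime_cycles_eq)

text \<open>That the prime cycles partition the prime geodesics, put as a reindexing so that a sum
  over prime geodesics can be taken cycle by cycle.\<close>

lemma bij_betw_snd_prime_cycles: "bij_betw snd (SIGMA p:prime_cycles F. p) (prime_geodesics F)"
  unfolding bij_betw_def
proof
  show "inj_on snd (SIGMA p:prime_cycles F. p)"
    by (auto simp: inj_on_def dest: prime_cycle_rotations(2))
  show "snd ` (SIGMA p:prime_cycles F. p) = prime_geodesics F" (is "snd ` ?S = _")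
  proof (intro equalityI subsetI)
    fix c assume "c \<in> prime_geodesics F"
    then have "(range (\<lambda>n. rotate n c), c) \<in> ?S"
      by (auto simp: prime_cycles_eq intro: range_eqI[of _ _ 0])
    then show "c \<in> snd ` ?S" by force
  qed (auto dest: prime_cycle_rotations)
qed

section \<open>Traces, determinants and matrices over finite index sets\<close>

definition mtrace :: "'a::comm_ring_1 mat \<Rightarrow> 'a" where
  "mtrace A = (\<Sum>i<dim_row A. A $$ (i, i))"

lemma index_mult_mat_sum:
  assumes "A \<in> carrier_mat n m" "B \<in> carrier_mat m k" "i < n" "j < k"
  shows "(A * B) $$ (i, j) = (\<Sum>l<m. A $$ (i, l) * B $$ (l, j))"
  using assms by (auto simp: scalar_prod_def atLeast0LessThan)

lemma mtrace_mult_commute: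
  assumes "A \<in> carrier_mat n m" "B \<in> carrier_mat m n"
  shows "mtrace (A * B) = mtrace (B * A)"
proof -
  have "mtrace (A * B) = (\<Sum>i<n. \<Sum>l<m. A $$ (i, l) * B $$ (l, i))"
    using assms by (simp add: mtrace_def index_mult_mat_sum del: index_mult_mat(1))
  also have "\<dots> = (\<Sum>l<m. \<Sum>i<n. B $$ (l, i) * A $$ (i, l))"
    by (subst sum.swap) (simp add: mult.commute)
  also have "\<dots> = mtrace (B * A)"
    using assms by (simp add: mtrace_def index_mult_mat_sum del: index_mult_mat(1))
  finally show ?thesis .
qed

lemma mtrace_similar_wit:
  assumes "similar_mat_wit A B P Q"
  shows "mtrace A = mtrace B"
proof -
  define n where "n = dim_row A"
  note * = similar_mat_witD[OF n_def assms]
  have "mtrace A = mtrace (P * (B * Q))"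
    using * by (simp add: assoc_mult_mat[of _ n n _ n _ n])
  also have "\<dots> = mtrace ((B * Q) * P)"
    using * by (intro mtrace_mult_commute) auto
  also have "(B * Q) * P = B"
    using * by (simp add: assoc_mult_mat[of _ n n _ n _ n])
  finally show ?thesis .
qed

lemma upper_triangular_pow:
  fixes B :: "'a::comm_ring_1 mat"
  assumes B: "B \<in> carrier_mat n n" and ut: "upper_triangular B"
  shows "upper_triangular (B ^\<^sub>m k) \<and> (\<forall>i<n. (B ^\<^sub>m k) $$ (i, i) = (B $$ (i, i)) ^ k)"
proof (induction k)
  case 0
  then show ?case using B by (auto simp: upper_triangular_def)
next
  case (Suc k)
  define C where "C = B ^\<^sub>m k"
  have C: "C \<in> carrier_mat n n" using B by (simp add: C_def)
  have zero: "B $$ (i, j) = 0" "C $$ (i, j) = 0" if "j < i" "i < n" for i j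
    using that ut Suc.IH B C by (auto simp: upper_triangular_def C_def)
  have "(C * B) $$ (i, j) = 0" if "j < i" "i < n" for i j
  proof -
    have "C $$ (i, l) * B $$ (l, j) = 0" if "l < n" for l
      using zero[of l i] zero[of j l] \<open>j < i\<close> \<open>i < n\<close> that by (cases "l < i") auto
    then show ?thesis using that by (simp add: index_mult_mat_sum[OF C B])
  qed
  moreover have "(C * B) $$ (i, i) = C $$ (i, i) * B $$ (i, i)" if "i < n" for i
  proof -
    have "C $$ (i, l) * B $$ (l, i) = 0" if "l < n" "l \<noteq> i" for l
      using zero[of l i] zero[of i l] \<open>i < n\<close> that by (cases "l < i") auto
    then have "(\<Sum>l<n. C $$ (i, l) * B $$ (l, i)) = (\<Sum>l\<in>{i}. C $$ (i, l) * B $$ (l, i))"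
      using \<open>i < n\<close> by (intro sum.mono_neutral_right) auto
    then show ?thesis using that by (simp add: index_mult_mat_sum[OF C B])
  qed
  moreover have "B ^\<^sub>m Suc k = C * B" by (simp add: C_def)
  ultimately show ?case
    using Suc.IH B C by (auto simp: upper_triangular_def C_def power_commutes)
qed

text \<open>For nonnegative \<open>b\<close> this bounds the operator norm induced by the sup norm.
  It makes sense for rectangular blocks, is submultiplicative, and controls diagonal entries as well
  as eigenvalues.\<close>

definition row_bounded :: "real \<Rightarrow> complex mat \<Rightarrow> bool" where
  "row_bounded b A \<longleftrightarrow> (\<forall>i<dim_row A. (\<Sum>j<dim_col A. norm (A $$ (i, j))) \<le> b)"

lemma row_bounded_mult:
  assumes "A \<in> carrier_mat n m" "B \<in> carrier_mat m k"
    and a: "row_bounded a A" and b: "row_bounded b B" and "b \<ge> 0"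
  shows "row_bounded (a * b) (A * B)"
  unfolding row_bounded_def
proof (intro allI impI)
  fix i assume "i < dim_row (A * B)"
  with assms have i: "i < n" by simp
  have "(\<Sum>j<k. norm ((A * B) $$ (i, j))) \<le> (\<Sum>j<k. \<Sum>l<m. norm (A $$ (i, l)) * norm (B $$ (l, j)))"
    using assms(1,2) i
    by (intro sum_mono) (simp add: index_mult_mat_sum sum_norm_le norm_mult del: index_mult_mat(1))
  also have "\<dots> = (\<Sum>l<m. norm (A $$ (i, l)) * (\<Sum>j<k. norm (B $$ (l, j))))"
    by (subst sum.swap) (simp add: sum_distrib_left)
  also have "\<dots> \<le> (\<Sum>l<m. norm (A $$ (i, l)) * b)"
    using b assms(2) by (intro sum_mono mult_left_mono) (auto simp: row_bounded_def)
  also have "\<dots> \<le> a * b"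
    using a assms(1) i \<open>b \<ge> 0\<close>
    by (auto simp: row_bounded_def sum_distrib_right[symmetric] intro!: mult_right_mono)
  finally show "(\<Sum>j<dim_col (A * B). norm ((A * B) $$ (i, j))) \<le> a * b"
    using assms by simp
qed

lemma norm_mtrace_le:
  assumes "A \<in> carrier_mat n n" "row_bounded b A"
  shows "norm (mtrace A) \<le> real n * b"
proof -
  have "norm (A $$ (i, i)) \<le> b" if "i < n" for i
  proof -
    have "norm (A $$ (i, i)) \<le> (\<Sum>j<n. norm (A $$ (i, j)))"
      using that by (intro member_le_sum) auto
    then show ?thesis using assms that by (auto simp: row_bounded_def intro: order_trans)
  qed
  then have "(\<Sum>i<n. norm (A $$ (i, i))) \<le> real (card {..<n}) * b"
    by (intro sum_bounded_above) auto
  then show ?thesis using assms(1) by (auto simp: mtrace_def intro: norm_sum[THEN order_trans])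
qed

text \<open>The eigenvector equation is read in a coordinate where \<open>v\<close> has its largest
  modulus; that modulus is positive and cancels.\<close>

lemma row_bounded_eigenvalue:
  assumes A: "A \<in> carrier_mat n n" and b: "row_bounded b A" and ev: "eigenvalue A c"
  shows "norm c \<le> b"
proof -
  obtain v where v: "v \<in> carrier_vec n" "v \<noteq> 0\<^sub>v n" "A *\<^sub>v v = c \<cdot>\<^sub>v v"
    using ev A by (auto simp: eigenvalue_def eigenvector_def)
  then have "\<exists>i<n. v $ i \<noteq> 0" by (metis carrier_vecD eq_vecI index_zero_vec)
  then have n: "{..<n} \<noteq> {}" by auto
  have "Max ((\<lambda>j. norm (v $ j)) ` {..<n}) \<in> (\<lambda>j. norm (v $ j)) ` {..<n}"
    using n by (intro Max_in) auto
  then obtain i where i: "i < n" and "Max ((\<lambda>j. norm (v $ j)) ` {..<n}) = norm (v $ i)"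
    by auto
  then have max: "norm (v $ j) \<le> norm (v $ i)" if "j < n" for j
    using that by (metis Max_ge finite_imageI finite_lessThan imageI lessThan_iff)
  have pos: "norm (v $ i) > 0"
  proof -
    obtain j where "j < n" "v $ j \<noteq> 0" using \<open>\<exists>i<n. v $ i \<noteq> 0\<close> by blast
    then have "0 < norm (v $ j)" "norm (v $ j) \<le> norm (v $ i)" using max by auto
    then show ?thesis by linarith
  qed
  have "norm c * norm (v $ i) = norm ((A *\<^sub>v v) $ i)"
    using v i by (simp add: norm_mult)
  also have "(A *\<^sub>v v) $ i = (\<Sum>j<n. A $$ (i, j) * v $ j)"
    using A v(1) i by (auto simp: scalar_prod_def atLeast0LessThan)
  also have "norm \<dots> \<le> (\<Sum>j<n. norm (A $$ (i, j)) * norm (v $ i))"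
    by (rule order_trans[OF norm_sum]) (auto simp: norm_mult intro!: sum_mono mult_left_mono max)
  also have "\<dots> \<le> b * norm (v $ i)"
    using b A i by (auto simp: row_bounded_def sum_distrib_right[symmetric] intro!: mult_right_mono)
  finally show ?thesis using pos by simp
qed

lemma triangularize:
  fixes A :: "complex mat"
  assumes A: "A \<in> carrier_mat n n"
  obtains B P Q where "similar_mat_wit A B P Q" "upper_triangular B" "B \<in> carrier_mat n n"
    "\<And>i. i < n \<Longrightarrow> eigenvalue A (B $$ (i, i))"
proof -
  obtain es where es: "char_poly A = (\<Prod>e\<leftarrow>es. [:- e, 1:])"
    using char_poly_factorized[OF A] by blast
  obtain B P Q where BPQ: "schur_decomposition A es = (B, P, Q)" by (metis prod_cases3)
  from schur_decomposition[OF A es BPQ]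
  have sim: "similar_mat_wit A B P Q" and ut: "upper_triangular B" and diag: "diag_mat B = es"
    by auto
  have B: "B \<in> carrier_mat n n" using similar_mat_witD2[OF A sim] by blast
  have "eigenvalue A (B $$ (i, i))" if "i < n" for i
  proof -
    have "B $$ (i, i) \<in> set es" using that B diag by (auto simp: diag_mat_def)
    then have "poly (char_poly A) (B $$ (i, i)) = 0"
      by (auto simp: es poly_prod_list prod_list_zero_iff image_iff)
    then show ?thesis using eigenvalue_root_char_poly[OF A] by blast
  qed
  with that sim ut B show ?thesis by blast
qed

text \<open>The change of basis that triangularizes \<open>A\<close> also triangularizes
  \<open>I - s A\<close>. The formula serves at \<open>s = 1\<close> for the logarithmic series, and
  as a polynomial in \<open>s\<close> for the analytic continuation.\<close>

lemma det_one_minus_smult_triangularized: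
  fixes A :: "complex mat"
  assumes A: "A \<in> carrier_mat n n" and sim: "similar_mat_wit A B P Q" and ut: "upper_triangular B"
  shows "Determinant.det (1\<^sub>m n - s \<cdot>\<^sub>m A) = (\<Prod>i<n. 1 - s * B $$ (i, i))"
proof -
  note * = similar_mat_witD2[OF A sim]
  define C where "C = 1\<^sub>m n - s \<cdot>\<^sub>m B"
  have "1\<^sub>m n - s \<cdot>\<^sub>m A = P * C * Q"
  proof -
    have "P * C * Q = (P - s \<cdot>\<^sub>m (P * B)) * Q"
      using * by (simp add: C_def mult_minus_distrib_mat[of _ n n _ n] mult_smult_distrib[of _ n n _ n])
    also have "\<dots> = 1\<^sub>m n - s \<cdot>\<^sub>m A"
      using * by (simp add: minus_mult_distrib_mat[of _ n n _ _ n] mult_smult_assoc_mat[of _ n n _ n])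
    finally show ?thesis ..
  qed
  then have "similar_mat_wit (1\<^sub>m n - s \<cdot>\<^sub>m A) C P Q"
    using *(1,2,4-7) by (intro similar_mat_witI[of _ _ n]) (auto simp: C_def)
  then have "Determinant.det (1\<^sub>m n - s \<cdot>\<^sub>m A) = Determinant.det C"
    by (intro det_similar) (auto simp: similar_mat_def)
  also have "\<dots> = prod_list (diag_mat C)"
    using *(5) ut by (intro det_upper_triangular[of _ n]) (auto simp: C_def upper_triangular_def)
  also have "\<dots> = (\<Prod>i<n. 1 - s * B $$ (i, i))"
    using *(5) by (auto simp: prod_list_diag_prod C_def atLeast0LessThan intro!: prod.cong)
  finally show ?thesis .
qed

lemma mtrace_pow_triangularized:
  fixes A :: "complex mat"
  assumes A: "A \<in> carrier_mat n n" and sim: "similar_mat_wit A B P Q" and ut: "upper_triangular B"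
  shows "mtrace (A ^\<^sub>m k) = (\<Sum>i<n. (B $$ (i, i)) ^ k)"
proof -
  have B: "B \<in> carrier_mat n n" using similar_mat_witD2[OF A sim] by blast
  have "mtrace (A ^\<^sub>m k) = mtrace (B ^\<^sub>m k)"
    using similar_mat_wit_pow[OF sim] by (rule mtrace_similar_wit)
  then show ?thesis using upper_triangular_pow[OF B ut] B by (simp add: mtrace_def)
qed

section \<open>The logarithmic series of a determinant\<close>

lemma has_sum_neg_Ln_one_minus:
  fixes z :: complex
  assumes "norm z < 1"
  shows "((\<lambda>k. z ^ k / of_nat k) has_sum - Ln (1 - z)) UNIV"
proof (rule norm_summable_imp_has_sum)
  show "summable (\<lambda>k. norm (z ^ k / of_nat k))"
  proof (rule summable_comparison_test[OF _ summable_geometric[of "norm z"]])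
    have "norm (z ^ k / of_nat k) \<le> norm z ^ k" for k
    proof (cases k)
      case (Suc j)
      then have "norm z ^ k / real k \<le> norm z ^ k / 1"
        by (intro divide_left_mono) auto
      then show ?thesis by (simp add: norm_divide norm_power)
    qed simp
    then show "\<exists>N. \<forall>k\<ge>N. norm (norm (z ^ k / of_nat k)) \<le> norm z ^ k" by auto
  qed (use assms in simp)
  \<comment> \<open>The quotient at \<open>k = 0\<close> is 1 divided by 0, hence 0, so the series
    may start there.\<close>
  have "(\<lambda>k. - (- ((- (- z)) ^ k) / of_nat k)) sums - Ln (1 + (- z))"
    by (intro sums_minus Ln_series') (use assms in simp)
  then show "(\<lambda>k. z ^ k / of_nat k) sums - Ln (1 - z)" by simp
qed

lemma one_smult_mat: "1 \<cdot>\<^sub>m A = (A :: 'a::semiring_1 mat)"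
  by (intro eq_matI) auto

lemma has_sum_sum_finite:
  fixes f :: "'i \<Rightarrow> 'a \<Rightarrow> 'b::topological_comm_monoid_add"
  assumes "finite I" "\<And>i. i \<in> I \<Longrightarrow> (f i has_sum s i) A"
  shows "((\<lambda>x. \<Sum>i\<in>I. f i x) has_sum (\<Sum>i\<in>I. s i)) A"
  using assms by (induction I rule: finite_induct) (auto intro: has_sum_add)

text \<open>\<open>L\<close> is the sum of \<open>- Ln (1 - \<lambda>)\<close> over the eigenvalues,
  which have modulus below 1. A sum of principal logarithms may differ from the principal logarithm
  of the product, so the determinant is tied to \<open>L\<close> only through \<open>exp\<close>.
  The lemma is applied both to the whole transfer matrix and to the loop of a single
  geodesic.\<close>

lemma has_sum_mtrace_powers:
  fixes A :: "complex mat"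
  assumes A: "A \<in> carrier_mat n n" and b: "row_bounded b A" "b < 1"
  obtains L where "((\<lambda>k. mtrace (A ^\<^sub>m k) / of_nat k) has_sum L) {0<..}"
    "exp (- L) = Determinant.det (1\<^sub>m n - A)"
proof -
  obtain B P Q where B: "similar_mat_wit A B P Q" "upper_triangular B"
      and ev: "\<And>i. i < n \<Longrightarrow> eigenvalue A (B $$ (i, i))"
    using triangularize[OF A] by metis
  have lt: "norm (B $$ (i, i)) < 1" if "i < n" for i
    using row_bounded_eigenvalue[OF A b(1) ev[OF that]] b(2) by simp
  define L where "L = (\<Sum>i<n. - Ln (1 - B $$ (i, i)))"
  have "((\<lambda>k. \<Sum>i<n. B $$ (i, i) ^ k / of_nat k) has_sum L) UNIV"
    unfolding L_def by (intro has_sum_sum_finite has_sum_neg_Ln_one_minus lt) auto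
  then have "((\<lambda>k. mtrace (A ^\<^sub>m k) / of_nat k) has_sum L) UNIV"
    by (simp add: mtrace_pow_triangularized[OF A B] sum_divide_distrib)
  then have "((\<lambda>k. mtrace (A ^\<^sub>m k) / of_nat k) has_sum L) {0<..}"
    by (subst has_sum_cong_neutral[of UNIV]) auto
  moreover have "exp (- L) = (\<Prod>i<n. 1 - B $$ (i, i))"
  proof -
    have "1 - B $$ (i, i) \<noteq> 0" if "i < n" for i using lt[OF that] by auto
    then show ?thesis by (simp add: L_def sum_negf exp_sum)
  qed
  then have "exp (- L) = Determinant.det (1\<^sub>m n - A)"
    using det_one_minus_smult_triangularized[OF A B, of 1] A
    by (simp add: one_smult_mat)
  ultimately show ?thesis by (rule that)
qed

text \<open>The block matrix \<open>X\<close> with identity diagonal blocks and off-diagonal blocks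
  \<open>A\<close>, \<open>B\<close> is factored twice, through the Schur complement of either
  diagonal block; the other factor always has determinant 1.\<close>

lemma det_one_minus_mult_commute:
  fixes A B :: "complex mat"
  assumes A: "A \<in> carrier_mat n m" and B: "B \<in> carrier_mat m n"
  shows "Determinant.det (1\<^sub>m n - A * B) = Determinant.det (1\<^sub>m m - B * A)"
proof -
  define X where "X = four_block_mat (1\<^sub>m n) A B (1\<^sub>m m)"
  have cancel: "Y + (1\<^sub>m k - Y) = 1\<^sub>m k" and cancel': "1\<^sub>m k - Y + Y = 1\<^sub>m k"
    if "Y \<in> carrier_mat k k" for Y :: "complex mat" and k
    using that by (auto intro!: eq_matI)
  have 1: "X = four_block_mat (1\<^sub>m n) (0\<^sub>m n m) B (1\<^sub>m m) *
      four_block_mat (1\<^sub>m n) A (0\<^sub>m m n) (1\<^sub>m m - B * A)"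
    unfolding X_def using A B cancel[of "B * A" m] minus_carrier_mat[OF mult_carrier_mat[OF B A]]
    by (subst mult_four_block_mat[of _ n n _ m _ m _ _ n _ m]) simp_all
  have 2: "X = four_block_mat (1\<^sub>m n - A * B) A (0\<^sub>m m n) (1\<^sub>m m) *
      four_block_mat (1\<^sub>m n) (0\<^sub>m n m) B (1\<^sub>m m)"
    unfolding X_def using A B cancel'[of "A * B" n] minus_carrier_mat[OF mult_carrier_mat[OF A B]]
    by (subst mult_four_block_mat[of _ n n _ m _ m _ _ n _ m]) simp_all
  have lower: "Determinant.det (four_block_mat (1\<^sub>m n) (0\<^sub>m n m) B (1\<^sub>m m)) = 1"
    using B by (subst det_four_block_mat_upper_right_zero[of _ n _ m]) auto
  have upper: "Determinant.det (four_block_mat (1\<^sub>m n) A (0\<^sub>m m n) (1\<^sub>m m - B * A)) =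
      Determinant.det (1\<^sub>m m - B * A)"
    using A B by (subst det_four_block_mat_lower_left_zero[of _ n _ m]) auto
  have upper': "Determinant.det (four_block_mat (1\<^sub>m n - A * B) A (0\<^sub>m m n) (1\<^sub>m m)) =
      Determinant.det (1\<^sub>m n - A * B)"
    using A B by (subst det_four_block_mat_lower_left_zero[of _ n _ m]) auto
  have "Determinant.det X = Determinant.det (1\<^sub>m m - B * A)"
    unfolding 1 using A B by (subst det_mult[of _ "n + m"]) (auto simp: lower upper)
  moreover have "Determinant.det X = Determinant.det (1\<^sub>m n - A * B)"
    unfolding 2 using A B by (subst det_mult[of _ "n + m"]) (auto simp: lower upper')
  ultimately show ?thesis by simp
qed

section \<open>Matrices indexed by finite sets, rectangular ones included since edges and vertices
  are both used as indices\<close>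

definition rmat_on :: "'i set \<Rightarrow> 'j set \<Rightarrow> ('i \<Rightarrow> 'j \<Rightarrow> complex) \<Rightarrow> complex mat" where
  "rmat_on I J A = Matrix.mat (card I) (card J)
     (\<lambda>(k, l). A (from_nat_into I k) (from_nat_into J l))"

lemma mat_on_eq_rmat_on: "mat_on I A = rmat_on I I A"
  by (simp add: mat_on_def rmat_on_def)

lemma rmat_on_carrier [simp]: "rmat_on I J A \<in> carrier_mat (card I) (card J)"
  by (simp add: rmat_on_def)

lemma mat_on_carrier [simp]: "mat_on I A \<in> carrier_mat (card I) (card I)"
  by (simp add: mat_on_def)

lemma dim_mat_on [simp]: "dim_row (mat_on I A) = card I" "dim_col (mat_on I A) = card I"
  by (simp_all add: mat_on_def)

lemma from_nat_into_in: "k < card I \<Longrightarrow> from_nat_into I k \<in> I"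
  by (metis card.empty from_nat_into less_zeroE)

lemma rmat_on_cong:
  "(\<And>x y. x \<in> I \<Longrightarrow> y \<in> J \<Longrightarrow> A x y = B x y) \<Longrightarrow> rmat_on I J A = rmat_on I J B"
  by (auto simp: rmat_on_def from_nat_into_in intro!: eq_matI)

lemma mat_on_cong:
  "(\<And>x y. x \<in> I \<Longrightarrow> y \<in> I \<Longrightarrow> A x y = B x y) \<Longrightarrow> mat_on I A = mat_on I B"
  unfolding mat_on_eq_rmat_on by (rule rmat_on_cong)

lemma sum_from_nat_into:
  "finite I \<Longrightarrow> (\<Sum>k<card I. f (from_nat_into I k)) = (\<Sum>x\<in>I. f x)"
  by (rule sum.reindex_bij_betw[OF bij_betw_from_nat_into_finite])

lemma rmat_on_mult:
  assumes "finite J"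
  shows "rmat_on I J A * rmat_on J K B = rmat_on I K (\<lambda>x z. \<Sum>y\<in>J. A x y * B y z)"
  (is "?L = ?R")
proof (rule eq_matI)
  fix i j assume "i < dim_row ?R" "j < dim_col ?R"
  then have "i < card I" "j < card K" by (simp_all add: rmat_on_def)
  then show "?L $$ (i, j) = ?R $$ (i, j)"
    using sum_from_nat_into[OF assms,
        of "\<lambda>y. A (from_nat_into I i) y * B y (from_nat_into K j)"]
    by (subst index_mult_mat_sum[OF rmat_on_carrier rmat_on_carrier]) (simp_all add: rmat_on_def)
qed (simp_all add: rmat_on_def)

lemma mat_on_mult:
  "finite I \<Longrightarrow> mat_on I A * mat_on I B = mat_on I (\<lambda>x z. \<Sum>y\<in>I. A x y * B y z)"
  by (simp add: mat_on_eq_rmat_on rmat_on_mult)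

lemma mat_on_minus: "mat_on I A - mat_on I B = mat_on I (\<lambda>x y. A x y - B x y)"
  by (auto simp: mat_on_def intro!: eq_matI)

lemma mat_on_smult: "s \<cdot>\<^sub>m mat_on I A = mat_on I (\<lambda>x y. s * A x y)"
  by (auto simp: mat_on_def intro!: eq_matI)

lemma mat_on_one: "finite I \<Longrightarrow> mat_on I (\<lambda>x y. if x = y then 1 else 0) = 1\<^sub>m (card I)"
  using bij_betw_imp_inj_on[OF bij_betw_from_nat_into_finite, of I]
  by (auto simp: mat_on_def inj_on_def intro!: eq_matI)

lemma mtrace_mat_on: "finite I \<Longrightarrow> mtrace (mat_on I A) = (\<Sum>x\<in>I. A x x)"
  using sum_from_nat_into[of I "\<lambda>x. A x x"] by (simp add: mtrace_def mat_on_def)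

lemma row_bounded_mat_on:
  assumes "finite I" "\<And>x. x \<in> I \<Longrightarrow> (\<Sum>y\<in>I. norm (A x y)) \<le> b"
  shows "row_bounded b (mat_on I A)"
  using assms sum_from_nat_into[OF assms(1), of "\<lambda>y. norm (A x y)" for x]
  by (auto simp: row_bounded_def mat_on_def from_nat_into_in)

text \<open>Another enumeration permutes rows and columns by the same permutation, so the two signs
  cancel. The columns are permuted as rows of the transpose.\<close>

lemma det_mat_on_bij:
  assumes "finite I" and g: "bij_betw g {..<card I} I"
  shows "Determinant.det (mat_on I A) =
    Determinant.det (Matrix.mat (card I) (card I) (\<lambda>(k, l). A (g k) (g l)))"
proof -
  define n where "n = card I"
  define f where "f = from_nat_into I"
  have f: "bij_betw f {..<n} I"
    unfolding f_def n_def by (rule bij_betw_from_nat_into_finite) fact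
  \<comment> \<open>\<open>p\<close> translates between the enumerations,
    \<open>f (p k) = g k\<close>; it is continued by the identity because \<open>permutes\<close>
    speaks of a function on all naturals.\<close>
  define p where "p k = (if k < n then inv_into {..<n} f (g k) else k)" for k
  have "bij_betw (inv_into {..<n} f \<circ> g) {..<n} {..<n}"
    using g bij_betw_inv_into[OF f] unfolding n_def by (rule bij_betw_trans)
  then have "bij_betw p {..<n} {..<n}"
    by (rule bij_betw_cong[THEN iffD1, rotated]) (simp add: p_def)
  then have p: "p permutes {0..<n}"
    by (intro bij_imp_permutes) (auto simp: p_def atLeast0LessThan)
  have fp: "f (p k) = g k" if "k < n" for k
    using that g f by (auto simp: p_def n_def bij_betw_def intro!: f_inv_into_f)
  have pn: "p k < n" if "k < n" for k
    using that permutes_in_image[OF p, of k] by simp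
  define B where "B = mat_on I A"
  have B: "B \<in> carrier_mat n n" by (simp add: B_def n_def)
  define C where "C = Matrix.mat n n (\<lambda>(i, j). B $$ (p i, j))"
  have C: "C \<in> carrier_mat n n" by (simp add: C_def)
  define D where "D = Matrix.mat n n (\<lambda>(i, j). (transpose_mat C) $$ (p i, j))"
  have D: "D \<in> carrier_mat n n" by (simp add: D_def)
  have "Determinant.det D = signof p * (signof p * Determinant.det B)"
    using det_permute_rows[OF B p] det_permute_rows[OF _ p, of "transpose_mat C"] C
    by (simp add: C_def[symmetric] D_def[symmetric] det_transpose)
  also have "\<dots> = Determinant.det B"
    by (simp add: sign_def)
  finally have "Determinant.det B = Determinant.det (transpose_mat D)"
    using det_transpose[OF D] by simp
  also have "transpose_mat D = Matrix.mat n n (\<lambda>(k, l). A (g k) (g l))"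
    using pn by (auto simp: D_def C_def B_def mat_on_def n_def[symmetric] f_def[symmetric] fp
        intro!: eq_matI)
  finally show ?thesis by (simp add: B_def n_def)
qed

lemma det_mat_on_reindex:
  assumes "finite J" and h: "bij_betw h J I"
  shows "Determinant.det (mat_on I A) = Determinant.det (mat_on J (\<lambda>x y. A (h x) (h y)))"
proof -
  have I: "finite I" "card I = card J"
    using assms(1) bij_betw_finite[OF h] bij_betw_same_card[OF h] by simp_all
  have "bij_betw (h \<circ> from_nat_into J) {..<card I} I"
    using bij_betw_trans[OF bij_betw_from_nat_into_finite[OF assms(1)] h] I by simp
  from det_mat_on_bij[OF I(1) this] show ?thesis by (simp add: I(2) mat_on_def)
qed

text \<open>An enumeration that lists \<open>I\<close> before \<open>J\<close> makes the matrix
  block lower triangular.\<close>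

lemma det_mat_on_Un:
  assumes fin: "finite I" "finite J" and disj: "I \<inter> J = {}"
    and zero: "\<And>x y. x \<in> I \<Longrightarrow> y \<in> J \<Longrightarrow> A x y = 0"
  shows "Determinant.det (mat_on (I \<union> J) A) =
    Determinant.det (mat_on I A) * Determinant.det (mat_on J A)"
proof -
  define m n where "m = card I" and "n = card J"
  define g where "g k = (if k < m then from_nat_into I k else from_nat_into J (k - m))" for k
  have card: "card (I \<union> J) = m + n"
    using fin disj by (simp add: m_def n_def card_Un_disjoint)
  have "bij_betw g {..<m} I"
    using bij_betw_from_nat_into_finite[OF fin(1), folded m_def]
    by (rule bij_betw_cong[THEN iffD1, rotated]) (simp add: g_def)
  moreover have "bij_betw g {m..<m + n} J"
  proof -
    have "bij_betw (\<lambda>k. k - m) {m..<m + n} {..<n}"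
      by (rule bij_betw_byWitness[of _ "\<lambda>k. k + m"]) auto
    from bij_betw_trans[OF this bij_betw_from_nat_into_finite[OF fin(2), folded n_def]]
    show ?thesis
      by (rule bij_betw_cong[THEN iffD1, rotated]) (simp add: g_def)
  qed
  ultimately have "bij_betw g ({..<m} \<union> {m..<m + n}) (I \<union> J)"
    using disj by (rule bij_betw_combine)
  also have "{..<m} \<union> {m..<m + n} = {..<card (I \<union> J)}" using card by auto
  finally have g: "bij_betw g {..<card (I \<union> J)} (I \<union> J)" .
  have "Determinant.det (mat_on (I \<union> J) A) =
      Determinant.det (Matrix.mat (m + n) (m + n) (\<lambda>(k, l). A (g k) (g l)))"
    using det_mat_on_bij[OF _ g] fin by (simp add: card)
  also have "Matrix.mat (m + n) (m + n) (\<lambda>(k, l). A (g k) (g l)) =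
      four_block_mat (mat_on I A) (0\<^sub>m m n) (rmat_on J I A) (mat_on J A)"
    using zero by (auto simp: mat_on_def rmat_on_def g_def m_def[symmetric] n_def[symmetric]
        intro!: eq_matI) (auto simp: m_def n_def from_nat_into_in)
  also have "Determinant.det \<dots> = Determinant.det (mat_on I A) * Determinant.det (mat_on J A)"
    by (rule det_four_block_mat_upper_right_zero[of _ m _ n]) (auto simp: m_def n_def)
  finally show ?thesis .
qed

section \<open>Products of weights along words\<close>

lemma finite_coords: "finite X \<Longrightarrow> finite (coords X r)"
  by (simp add: coords_def)

lemma sum_coords: "finite X \<Longrightarrow> (\<Sum>x\<in>coords X r. f x) = (\<Sum>e\<in>X. \<Sum>a<r e. f (e, a))"
  by (simp add: coords_def sum.Sigma)

text \<open>For \<open>c = [e\<^sub>1, \<dots>, e\<^sub>k]\<close> this is the product \<open>w e\<^sub>k f * w e\<^bsub>k-1\<^esub> e\<^sub>k * \<dots> * w e\<^sub>1 e\<^sub>2\<close>.\<close>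

primrec chain_weight :: "('e \<Rightarrow> nat) \<Rightarrow> ('e \<Rightarrow> 'e \<Rightarrow> complex mat) \<Rightarrow> 'e list \<Rightarrow> 'e \<Rightarrow> complex mat"
  where
    "chain_weight r w [] f = 1\<^sub>m (r f)"
  | "chain_weight r w (e # c) f = chain_weight r w c f * w e (hd (c @ [f]))"

text \<open>Weights are given for all pairs in \<open>E\<close>, so that walks are just words; a
  missing arrow is represented by a zero matrix.\<close>

locale weighted_digraph =
  fixes E :: "'e set" and r :: "'e \<Rightarrow> nat" and w :: "'e \<Rightarrow> 'e \<Rightarrow> complex mat"
  assumes finite_E: "finite E"
    and weight_carrier: "e \<in> E \<Longrightarrow> f \<in> E \<Longrightarrow> w e f \<in> carrier_mat (r f) (r e)"
begin

abbreviation chain where "chain \<equiv> chain_weight r w"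

definition loop where "loop c = chain c (hd c)"

definition words where "words n = {c. set c \<subseteq> E \<and> length c = n}"

definition transfer where
  "transfer = mat_on (coords E r) (\<lambda>(f, a) (e, b). w e f $$ (a, b))"

lemma transfer_carrier: "transfer \<in> carrier_mat (card (coords E r)) (card (coords E r))"
  by (simp add: transfer_def)

lemma finite_words: "finite (words n)"
  using finite_lists_length_eq[OF finite_E] by (simp add: words_def)

lemma card_words: "card (words n) = card E ^ n"
  using card_lists_length_eq[OF finite_E] by (simp add: words_def)

lemma hd_append_in: "set c \<subseteq> E \<Longrightarrow> f \<in> E \<Longrightarrow> hd (c @ [f]) \<in> E"
  by (cases c) auto

lemma chain_carrier:
  "set c \<subseteq> E \<Longrightarrow> f \<in> E \<Longrightarrow> chain c f \<in> carrier_mat (r f) (r (hd (c @ [f])))"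
proof (induction c)
  case (Cons e c)
  then have "chain c f \<in> carrier_mat (r f) (r (hd (c @ [f])))" by simp
  moreover have "w e (hd (c @ [f])) \<in> carrier_mat (r (hd (c @ [f]))) (r e)"
    using Cons.prems by (intro weight_carrier hd_append_in) auto
  ultimately show ?case by simp
qed simp

lemma loop_carrier:
  assumes "c \<noteq> []" "set c \<subseteq> E"
  shows "loop c \<in> carrier_mat (r (hd c)) (r (hd c))"
  using chain_carrier[of c "hd c"] assms by (simp add: loop_def subset_iff)

text \<open>The walk along \<open>c\<close> ends where \<open>d\<close> begins, or at
  \<open>f\<close> if \<open>d\<close> is empty; \<open>hd (d @ [f])\<close> covers both
  cases.\<close>

lemma chain_append:
  assumes "set c \<subseteq> E" "set d \<subseteq> E" "f \<in> E"
  shows "chain (c @ d) f = chain d f * chain c (hd (d @ [f]))"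
  using assms
proof (induction c)
  case Nil
  then show ?case using chain_carrier[of d f] by simp
next
  case (Cons e c)
  define g where "g = hd (d @ [f])"
  have g: "g \<in> E" using Cons.prems by (simp add: g_def hd_append_in)
  have hd: "hd (c @ d @ [f]) = hd (c @ [g])" by (cases c) (simp_all add: g_def)
  have "w e (hd (c @ [g])) \<in> carrier_mat (r (hd (c @ [g]))) (r e)"
    using Cons.prems g by (intro weight_carrier hd_append_in) auto
  moreover have "chain c g \<in> carrier_mat (r g) (r (hd (c @ [g])))"
    using Cons.prems g by (intro chain_carrier) auto
  moreover have "chain d f \<in> carrier_mat (r f) (r g)"
    using Cons.prems chain_carrier[of d f] by (simp add: g_def)
  moreover have "chain (c @ d) f = chain d f * chain c g"
    using Cons.IH Cons.prems by (simp add: g_def)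
  ultimately show ?case by (simp add: g_def[symmetric] hd)
qed

text \<open>The end point is held at \<open>hd c\<close> instead of being read off the repeated
  word, so the induction can start from the empty word.\<close>

lemma loop_power:
  assumes "c \<noteq> []" "set c \<subseteq> E"
  shows "chain (concat (replicate m c)) (hd c) = loop c ^\<^sub>m m"
proof (induction m)
  case 0
  then show ?case using loop_carrier[OF assms] by simp
next
  case (Suc m)
  have "hd c \<in> E" using assms by auto
  moreover have "hd (concat (replicate m c) @ [hd c]) = hd c"
    using assms by (cases m) auto
  moreover have "set (concat (replicate m c)) \<subseteq> E" using assms by auto
  ultimately show ?case using Suc assms by (simp add: chain_append loop_def)
qed

lemma loop_concat_replicate:
  assumes "c \<noteq> []" "set c \<subseteq> E" "m > 0"
  shows "loop (concat (replicate m c)) = loop c ^\<^sub>m m"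
  using loop_power[OF assms(1,2), of m] assms by (simp add: loop_def hd_concat_replicate)

text \<open>Moving the first letter to the end moves the rightmost factor of the product to the
  left, which the trace does not see.\<close>

lemma mtrace_loop_rotate1:
  assumes "set c \<subseteq> E"
  shows "mtrace (loop (rotate1 c)) = mtrace (loop c)"
proof (cases c)
  case (Cons e d)
  define g where "g = hd (d @ [e])"
  have E: "e \<in> E" "set d \<subseteq> E" "g \<in> E"
    using assms by (auto simp: Cons g_def intro: hd_append_in)
  have w: "w e g \<in> carrier_mat (r g) (r e)" using E by (intro weight_carrier)
  have d: "chain d e \<in> carrier_mat (r e) (r g)"
    using E chain_carrier[of d e] by (simp add: g_def)
  have "loop (rotate1 c) = w e g * chain d e"
    using E w by (simp add: Cons loop_def g_def[symmetric] chain_append)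
  moreover have "loop c = chain d e * w e g"
    by (simp add: Cons loop_def g_def)
  ultimately show ?thesis using mtrace_mult_commute[OF w d] by simp
qed simp

lemma mtrace_loop_rotate:
  assumes "set c \<subseteq> E"
  shows "mtrace (loop (rotate n c)) = mtrace (loop c)"
  using assms by (induction n) (simp_all add: mtrace_loop_rotate1)

lemma row_bounded_chain:
  assumes b: "\<And>e f. e \<in> E \<Longrightarrow> f \<in> E \<Longrightarrow> row_bounded b (w e f)" "b \<ge> 0"
    and "set c \<subseteq> E" "f \<in> E"
  shows "row_bounded (b ^ length c) (chain c f)"
  using assms(3,4)
proof (induction c)
  case Nil
  have "(\<Sum>j<r f. norm ((1\<^sub>m (r f) :: complex mat) $$ (i, j))) = (\<Sum>j<r f. if j = i then 1 else 0)"
    if "i < r f" for i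
    using that by (intro sum.cong) auto
  then show ?case by (auto simp: row_bounded_def)
next
  case (Cons e c)
  have "hd (c @ [f]) \<in> E" using Cons.prems by (intro hd_append_in) auto
  then have "row_bounded (b ^ length c * b) (chain c f * w e (hd (c @ [f])))"
    using Cons by (intro row_bounded_mult[OF chain_carrier weight_carrier] b) auto
  then show ?case by (simp add: mult.commute)
qed

text \<open>The walk expansion of a matrix power. A word lists the first \<open>n\<close> edges of a
  walk and the last edge \<open>f\<close> is kept apart, so the condition on its start also makes
  sense for \<open>n = 0\<close>. One more factor on the right prepends a letter.\<close>

lemma transfer_power:
  "transfer ^\<^sub>m n = mat_on (coords E r)
     (\<lambda>(f, a) (e, b). \<Sum>c | c \<in> words n \<and> hd (c @ [f]) = e. chain c f $$ (a, b))"
proof (induction n)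
  case 0
  have "(\<Sum>c | c \<in> words 0 \<and> hd (c @ [f]) = e. chain c f $$ (a, b)) =
      (if f = e then (1\<^sub>m (r f)) $$ (a, b) else 0)" for f e a b
  proof -
    have "{c. c \<in> words 0 \<and> hd (c @ [f]) = e} = (if f = e then {[]} else {})"
      by (auto simp: words_def)
    then show ?thesis by simp
  qed
  then have "mat_on (coords E r)
      (\<lambda>(f, a) (e, b). \<Sum>c | c \<in> words 0 \<and> hd (c @ [f]) = e. chain c f $$ (a, b)) =
      mat_on (coords E r) (\<lambda>x y. if x = y then 1 else 0)"
    by (intro mat_on_cong) (auto simp: coords_def split: if_splits)
  then show ?case
    by (simp add: mat_on_one finite_coords finite_E transfer_def)
next
  case (Suc n)
  have "(\<Sum>(g, d)\<in>coords E r. (\<Sum>c | c \<in> words n \<and> hd (c @ [f]) = g. chain c f $$ (a, d)) *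
      w e g $$ (d, b)) = (\<Sum>c | c \<in> words (Suc n) \<and> hd (c @ [f]) = e. chain c f $$ (a, b))"
    if f: "f \<in> E" and a: "a < r f" and e: "e \<in> E" and b: "b < r e" for f e a b
  proof -
    have step: "(\<Sum>d<r g. chain c f $$ (a, d) * w e g $$ (d, b)) = chain (e # c) f $$ (a, b)"
      if "c \<in> words n" "hd (c @ [f]) = g" for c g
    proof -
      have c: "set c \<subseteq> E" using that by (simp add: words_def)
      have "g \<in> E" using that f c hd_append_in by blast
      then have "w e g \<in> carrier_mat (r g) (r e)" using e by (intro weight_carrier)
      moreover have "chain c f \<in> carrier_mat (r f) (r g)"
        using chain_carrier[OF c f] that by simp
      ultimately show ?thesis
        using a b that by (simp add: index_mult_mat_sum del: index_mult_mat(1))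
    qed
    have "(\<Sum>(g, d)\<in>coords E r. (\<Sum>c | c \<in> words n \<and> hd (c @ [f]) = g. chain c f $$ (a, d)) *
        w e g $$ (d, b)) =
        (\<Sum>g\<in>E. \<Sum>d<r g. \<Sum>c | c \<in> words n \<and> hd (c @ [f]) = g. chain c f $$ (a, d) * w e g $$ (d, b))"
      by (simp add: sum_coords finite_E sum_distrib_right)
    also have "\<dots> = (\<Sum>g\<in>E. \<Sum>c | c \<in> words n \<and> hd (c @ [f]) = g. chain (e # c) f $$ (a, b))"
      by (intro sum.cong refl, subst sum.swap, intro sum.cong refl step) auto
    \<comment> \<open>The intermediate edge \<open>g\<close> is determined by \<open>c\<close>, so
      summing over \<open>g\<close> just removes the constraint.\<close>
    also have "\<dots> = (\<Sum>c\<in>words n. chain (e # c) f $$ (a, b))"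
      using f by (intro sum.group finite_words finite_E) (auto simp: words_def intro: hd_append_in)
    also have "\<dots> = (\<Sum>c\<in>(#) e ` words n. chain c f $$ (a, b))"
      by (simp add: sum.reindex)
    also have "(#) e ` words n = {c. c \<in> words (Suc n) \<and> hd (c @ [f]) = e}"
      using e by (auto simp: words_def length_Suc_conv)
    finally show ?thesis .
  qed
  then show ?case
    unfolding pow_mat.simps Suc
    unfolding transfer_def mat_on_mult[OF finite_coords[OF finite_E]]
    by (intro mat_on_cong) (auto simp: coords_def split_def)
qed

text \<open>On the diagonal a walk ends at its own first letter, which exists because
  \<open>n > 0\<close>.\<close>

lemma mtrace_transfer_power:
  assumes "n > 0"
  shows "mtrace (transfer ^\<^sub>m n) = (\<Sum>c\<in>words n. mtrace (loop c))"
proof -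
  have hd: "hd (c @ [f]) = hd c" if "c \<in> words n" for c f
    using that assms by (auto simp: words_def)
  have "mtrace (transfer ^\<^sub>m n) =
      (\<Sum>e\<in>E. \<Sum>a<r e. \<Sum>c | c \<in> words n \<and> hd (c @ [e]) = e. chain c e $$ (a, a))"
    by (simp add: transfer_power mtrace_mat_on finite_coords finite_E sum_coords)
  also have "\<dots> = (\<Sum>e\<in>E. \<Sum>c | c \<in> words n \<and> hd c = e. mtrace (loop c))"
  proof (intro sum.cong refl, subst sum.swap, rule sum.cong)
    fix e assume "e \<in> E"
    show "{c. c \<in> words n \<and> hd (c @ [e]) = e} = {c. c \<in> words n \<and> hd c = e}"
      using hd by auto
    fix c assume "c \<in> {c. c \<in> words n \<and> hd c = e}"
    then have "c \<noteq> []" "set c \<subseteq> E" "hd c = e" using assms by (auto simp: words_def)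
    with loop_carrier[of c] show "(\<Sum>a<r e. chain c e $$ (a, a)) = mtrace (loop c)"
      by (simp add: mtrace_def loop_def)
  qed
  also have "\<dots> = (\<Sum>c\<in>words n. mtrace (loop c))"
    using assms by (intro sum.group finite_words finite_E) (auto simp: words_def)
  finally show ?thesis .
qed

text \<open>A row of the transfer matrix runs through one block for each edge, each contributing at
  most \<open>b\<close>.\<close>

lemma row_bounded_transfer:
  assumes b: "\<And>e f. e \<in> E \<Longrightarrow> f \<in> E \<Longrightarrow> row_bounded b (w e f)"
  shows "row_bounded (real (card E) * b) transfer"
  unfolding transfer_def
proof (rule row_bounded_mat_on)
  fix x assume "x \<in> coords E r"
  then obtain f a where x: "x = (f, a)" "f \<in> E" "a < r f" by (auto simp: coords_def)
  have "(\<Sum>b<r e. norm (w e f $$ (a, b))) \<le> b" if "e \<in> E" for e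
    using b[OF that x(2)] weight_carrier[OF that x(2)] x(3) by (auto simp: row_bounded_def)
  then have "(\<Sum>e\<in>E. \<Sum>b<r e. norm (w e f $$ (a, b))) \<le> real (card E) * b"
    by (rule sum_bounded_above)
  then show "(\<Sum>y\<in>coords E r. norm ((\<lambda>(f, a) (e, b). w e f $$ (a, b)) x y)) \<le> real (card E) * b"
    by (simp add: x sum_coords finite_E)
qed (simp add: finite_coords finite_E)

end

lemma geodesic_weight_eq_loop:
  assumes "weighted_digraph E r w" and c: "c \<noteq> []" "set c \<subseteq> E"
  shows "geodesic_weight r w c = weighted_digraph.loop r w c"
proof -
  interpret weighted_digraph E r w by fact
  define k where "k = length c"
  have k: "k > 0" using c by (simp add: k_def)
  define step where "step = (\<lambda>l P. w (c ! l) (c ! (Suc l mod k)) * P)"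
  \<comment> \<open>After \<open>j\<close> steps the fold has walked along the first
    \<open>j\<close> letters and stands at the next one; the \<open>mod\<close> matters only at
    \<open>j = k\<close>, where it returns to the first letter.\<close>
  have "fold step [0..<j] (1\<^sub>m (r (hd c))) = chain (take j c) (c ! (j mod k))" if "j \<le> k" for j
    using that
  proof (induction j)
    case 0
    then show ?case using c by (simp add: hd_conv_nth)
  next
    case (Suc j)
    define g where "g = c ! (Suc j mod k)"
    have E: "c ! j \<in> E" "g \<in> E"
      using Suc.prems c(2) k nth_mem[of _ c] by (auto simp: k_def g_def)
    have "take (Suc j) c = take j c @ [c ! j]"
      using Suc.prems by (simp add: take_Suc_conv_app_nth k_def)
    moreover have "set (take j c) \<subseteq> E" using c(2) by (auto dest: in_set_takeD)
    ultimately have "chain (take (Suc j) c) g = w (c ! j) g * chain (take j c) (c ! j)"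
      using E weight_carrier[OF E] by (simp add: chain_append)
    then show ?case using Suc by (simp add: step_def g_def)
  qed
  from this[of k] show ?thesis
    using c by (simp add: geodesic_weight_def step_def k_def loop_def hd_conv_nth)
qed

section \<open>The Euler product and its continuation\<close>

text \<open>The zero matrix has the size that the pair of edges requires, so all products along
  words are well-formed even where \<open>w\<close> itself is arbitrary.\<close>

definition follows_weight ::
    "('v dedge \<Rightarrow> 'v dedge \<Rightarrow> complex mat) \<Rightarrow> ('v dedge \<Rightarrow> nat) \<Rightarrow> 'v dedge \<Rightarrow> 'v dedge \<Rightarrow> complex mat" where
  "follows_weight w r e f = (if e \<rightharpoonup> f then w e f else 0\<^sub>m (r f) (r e))"

lemma geodesic_weight_follows_weight:
  assumes "c \<in> closed_geodesics F"
  shows "geodesic_weight r (follows_weight w r) c = geodesic_weight r w c"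
proof -
  have "follows_weight w r (c ! l) (c ! (Suc l mod length c)) = w (c ! l) (c ! (Suc l mod length c))"
    if "l \<in> set [0..<length c]" for l
    using that assms by (simp add: follows_weight_def closed_geodesics_def)
  note eq = this
  show ?thesis
    unfolding geodesic_weight_def by (rule List.fold_cong[OF refl refl]) (simp only: eq)
qed

section \<open>Words of directed edges and closed geodesics\<close>

locale weighted_hypergraph =
  fixes F :: "'v set set" and r :: "'v dedge \<Rightarrow> nat" and w :: "'v dedge \<Rightarrow> 'v dedge \<Rightarrow> complex mat"
  assumes finite_dedges: "finite (dedges F)"
    and follows_carrier: "e \<in> dedges F \<Longrightarrow> f \<in> dedges F \<Longrightarrow> e \<rightharpoonup> f \<Longrightarrow> w e f \<in> carrier_mat (r f) (r e)"
begin

sublocale weighted_digraph "dedges F" r "follows_weight w r"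
  by unfold_locales (auto simp: finite_dedges follows_weight_def follows_carrier)

lemma closed_geodesic_words: "c \<in> closed_geodesics F \<Longrightarrow> c \<noteq> [] \<and> set c \<subseteq> dedges F"
  by (simp add: closed_geodesics_def)

lemma geodesic_weight_loop: "c \<in> closed_geodesics F \<Longrightarrow> geodesic_weight r w c = loop c"
  using geodesic_weight_eq_loop[OF weighted_digraph_axioms] closed_geodesic_words
    geodesic_weight_follows_weight by metis

text \<open>A pair that does not follow contributes a zero factor. Rotation preserves the trace and
  brings this pair to the front, where its weight is the rightmost factor of the product.\<close>

lemma mtrace_loop_eq_0:
  assumes c: "c \<noteq> []" "set c \<subseteq> dedges F" and "c \<notin> closed_geodesics F"
  shows "mtrace (loop c) = 0"
proof -
  obtain l where l: "l < length c" "\<not> c ! l \<rightharpoonup> c ! (Suc l mod length c)"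
    using assms by (auto simp: closed_geodesics_def)
  define c' where "c' = rotate l c"
  have c': "c' \<noteq> []" "set c' \<subseteq> dedges F" using c by (simp_all add: c'_def)
  then obtain e d where ed: "c' = e # d" by (cases c') auto
  have "e = c ! l"
    using ed l c nth_rotate[of 0 c l] by (simp add: c'_def)
  \<comment> \<open>This is the cyclic successor of \<open>e\<close> also for a one-letter word,
    where it is \<open>e\<close> itself.\<close>
  moreover have "hd (d @ [e]) = c' ! (Suc 0 mod length c')"
    by (cases d) (simp_all add: ed)
  then have "hd (d @ [e]) = c ! (Suc l mod length c)"
  proof -
    have "rotate l c ! (Suc 0 mod length c) = c ! ((l + Suc 0 mod length c) mod length c)"
      using c by (intro nth_rotate mod_less_divisor) simp
    also have "(l + Suc 0 mod length c) mod length c = Suc l mod length c"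
      by (simp only: mod_add_right_eq add_Suc_right add_0_right)
    finally show ?thesis
      using \<open>hd (d @ [e]) = c' ! (Suc 0 mod length c')\<close> by (simp only: c'_def length_rotate)
  qed
  ultimately have "\<not> e \<rightharpoonup> hd (d @ [e])" using l by simp
  moreover have "chain d e \<in> carrier_mat (r e) (r (hd (d @ [e])))"
    using c' ed by (intro chain_carrier) auto
  ultimately have "loop c' = 0\<^sub>m (r e) (r e)"
    by (simp add: ed loop_def follows_weight_def)
  then have "mtrace (loop c') = 0" by (simp add: mtrace_def)
  then show ?thesis using mtrace_loop_rotate[OF c(2), of l] by (simp add: c'_def)
qed

end

text \<open>\<open>b < 1\<close> makes the logarithmic series of every single loop converge. The
  bound on \<open>card (dedges F) * b\<close> handles the total over all words: there are
  \<open>card (dedges F) ^ n\<close> of length \<open>n\<close>, each of size at most a constant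
  times \<open>b ^ n\<close>.\<close>

locale small_weighted_hypergraph = weighted_hypergraph +
  fixes b :: real
  assumes row_bounded_weight: "e \<in> dedges F \<Longrightarrow> f \<in> dedges F \<Longrightarrow> row_bounded b (follows_weight w r e f)"
    and b: "0 \<le> b" "b < 1" "real (card (dedges F)) * b < 1"
begin

definition geodesic_term :: "'a dedge list \<Rightarrow> complex" where
  "geodesic_term c = mtrace (loop c) / of_nat (length c)"

lemma row_bounded_loop:
  assumes "c \<noteq> []" "set c \<subseteq> dedges F"
  shows "row_bounded (b ^ length c) (loop c)"
  using assms b(1) row_bounded_weight unfolding loop_def by (intro row_bounded_chain) auto

text \<open>The trace bound carries the dimension at \<open>hd c\<close>; the total dimension
  replaces it to be uniform in \<open>c\<close>.\<close>

lemma norm_geodesic_term_le: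
  assumes "c \<noteq> []" "set c \<subseteq> dedges F"
  shows "norm (geodesic_term c) \<le> real (\<Sum>e\<in>dedges F. r e) * b ^ length c"
proof -
  have "r (hd c) \<le> (\<Sum>e\<in>dedges F. r e)"
    using assms finite_dedges by (intro member_le_sum) auto
  then have "real (r (hd c)) * b ^ length c \<le> real (\<Sum>e\<in>dedges F. r e) * b ^ length c"
    using b by (intro mult_right_mono) (simp_all only: of_nat_le_iff zero_le_power)
  then have "norm (mtrace (loop c)) \<le> real (\<Sum>e\<in>dedges F. r e) * b ^ length c"
    using norm_mtrace_le[OF loop_carrier row_bounded_loop] assms by fastforce
  moreover have "norm (geodesic_term c) \<le> norm (mtrace (loop c)) / 1"
    using assms unfolding geodesic_term_def norm_divide
    by (intro divide_left_mono) (auto simp: Suc_le_eq)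
  ultimately show ?thesis by simp
qed

text \<open>Absolute convergence over all nonempty words is what later permits regrouping, by length
  on one side and by prime cycle on the other.\<close>

lemma geodesic_term_summable: "(\<lambda>(n, c). geodesic_term c) summable_on (SIGMA n:{0<..}. words n)"
proof (rule abs_summable_summable)
  define R where "R = real (\<Sum>e\<in>dedges F. r e)"
  have "(\<lambda>(n, c). R * b ^ n) summable_on (SIGMA n:{0<..}. words n)"
  proof (rule summable_on_SigmaI)
    show "((\<lambda>c. case (n, c) of (n, c) \<Rightarrow> R * b ^ n) has_sum R * (real (card (dedges F)) * b) ^ n) (words n)"
      for n
      by (rule has_sum_finiteI) (simp_all add: finite_words card_words power_mult_distrib)
    have "summable (\<lambda>n. R * (real (card (dedges F)) * b) ^ n)"
      using b by (intro summable_mult summable_geometric) simp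
    then have "(\<lambda>n. R * (real (card (dedges F)) * b) ^ n) summable_on UNIV"
      using b by (intro summable_nonneg_imp_summable_on) (auto simp: R_def intro!: mult_nonneg_nonneg sum_nonneg)
    then show "(\<lambda>n. R * (real (card (dedges F)) * b) ^ n) summable_on {0<..}"
      by (rule summable_on_subset_banach) simp
  qed (use b in \<open>auto simp: R_def intro!: mult_nonneg_nonneg sum_nonneg\<close>)
  then have "(\<lambda>x. norm (case x of (n, c) \<Rightarrow> R * b ^ n)) summable_on (SIGMA n:{0<..}. words n)"
    by (rule summable_on_iff_abs_summable_on_real[THEN iffD1])
  then show "(\<lambda>x. norm (case x of (n, c) \<Rightarrow> geodesic_term c)) summable_on (SIGMA n:{0<..}. words n)"
    by (rule Infinite_Sum.abs_summable_on_comparison_test)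
      (use norm_geodesic_term_le in \<open>force simp: R_def words_def intro: order_trans[OF _ abs_ge_self]\<close>)
qed

text \<open>Grouped by length, the sum over words is the trace series of the transfer matrix, so its
  value exponentiates to the determinant; dropping the words that are not closed geodesics removes
  only zeros.\<close>

lemma has_sum_geodesic_term:
  obtains L where "(geodesic_term has_sum L) (closed_geodesics F)"
    "exp (- L) = Determinant.det (1\<^sub>m (card (coords (dedges F) r)) - transfer)"
proof -
  obtain L where L: "((\<lambda>(n, c). geodesic_term c) has_sum L) (SIGMA n:{0<..}. words n)"
    using geodesic_term_summable by (auto simp: summable_on_def)
  have "((\<lambda>n. mtrace (transfer ^\<^sub>m n) / of_nat n) has_sum L) {0<..}"
  proof (rule has_sum_SigmaD[OF L])
    fix n :: nat assume "n \<in> {0<..}"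
    then show "((\<lambda>c. case (n, c) of (n, c) \<Rightarrow> geodesic_term c) has_sum mtrace (transfer ^\<^sub>m n) / of_nat n) (words n)"
      by (intro has_sum_finiteI finite_words)
        (auto simp: mtrace_transfer_power sum_divide_distrib geodesic_term_def words_def intro!: sum.cong)
  qed
  moreover obtain L' where "((\<lambda>n. mtrace (transfer ^\<^sub>m n) / of_nat n) has_sum L') {0<..}"
    "exp (- L') = Determinant.det (1\<^sub>m (card (coords (dedges F) r)) - transfer)"
    using has_sum_mtrace_powers[OF transfer_carrier row_bounded_transfer[OF row_bounded_weight] b(3)]
    by blast
  ultimately have "exp (- L) = Determinant.det (1\<^sub>m (card (coords (dedges F) r)) - transfer)"
    using has_sum_unique by metis
  moreover have "(geodesic_term has_sum L) (closed_geodesics F)"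
  proof -
    have "bij_betw snd (SIGMA n:{0<..}. words n) {c. c \<noteq> [] \<and> set c \<subseteq> dedges F}"
      by (rule bij_betw_byWitness[of _ "\<lambda>c. (length c, c)"]) (auto simp: words_def)
    then have "(geodesic_term has_sum L) {c. c \<noteq> [] \<and> set c \<subseteq> dedges F}"
      using L by (subst has_sum_reindex_bij_betw[symmetric]) (simp_all add: split_def)
    then show ?thesis
      by (rule has_sum_cong_neutral[THEN iffD1, rotated -1])
        (auto simp: geodesic_term_def mtrace_loop_eq_0 dest: closed_geodesic_words)
  qed
  ultimately show ?thesis using that by blast
qed

text \<open>A branch of minus the logarithm of \<open>det (I - \<pi>(c))\<close>. Being defined by
  the trace series, it depends on the traces of powers alone.\<close>

definition log_det :: "'a dedge list \<Rightarrow> complex" where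
  "log_det c = (\<Sum>\<^sub>\<infinity>m\<in>{0<..}. mtrace (loop c ^\<^sub>m m) / of_nat m)"

lemma log_det:
  assumes "c \<in> closed_geodesics F"
  shows "((\<lambda>m. mtrace (loop c ^\<^sub>m m) / of_nat m) has_sum log_det c) {0<..}"
    and "exp (- log_det c) = Determinant.det (1\<^sub>m (r (hd c)) - geodesic_weight r w c)"
proof -
  have c: "c \<noteq> []" "set c \<subseteq> dedges F" using closed_geodesic_words assms by auto
  have "b ^ length c < 1" using b c by (simp add: power_less_one_iff)
  then obtain L where L: "((\<lambda>m. mtrace (loop c ^\<^sub>m m) / of_nat m) has_sum L) {0<..}"
    and "exp (- L) = Determinant.det (1\<^sub>m (r (hd c)) - loop c)"
    using has_sum_mtrace_powers[OF loop_carrier row_bounded_loop] c by metis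
  moreover have "log_det c = L" unfolding log_det_def using L by (rule infsumI)
  ultimately show "((\<lambda>m. mtrace (loop c ^\<^sub>m m) / of_nat m) has_sum log_det c) {0<..}"
    and "exp (- log_det c) = Determinant.det (1\<^sub>m (r (hd c)) - geodesic_weight r w c)"
    by (simp_all add: geodesic_weight_loop assms)
qed

text \<open>A power of the rotated loop is the loop of a rotated power, so rotation invariance of
  the trace applies to every term.\<close>

lemma log_det_rotate:
  assumes "c \<in> closed_geodesics F"
  shows "log_det (rotate n c) = log_det c"
proof -
  have c: "c \<noteq> []" "set c \<subseteq> dedges F" using closed_geodesic_words assms by auto
  have "mtrace (loop (rotate n c) ^\<^sub>m m) = mtrace (loop c ^\<^sub>m m)" if "m > 0" for m
  proof -
    have "mtrace (loop (rotate n c) ^\<^sub>m m) = mtrace (loop (rotate n (concat (replicate m c))))"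
      using c that by (subst loop_concat_replicate[symmetric]) (simp_all add: rotate_concat_replicate)
    also have "\<dots> = mtrace (loop c ^\<^sub>m m)"
      using c that by (subst mtrace_loop_rotate) (auto simp: loop_concat_replicate)
    finally show ?thesis .
  qed
  then show ?thesis unfolding log_det_def by (intro infsum_cong) simp
qed

text \<open>Every closed geodesic is a power of a unique prime one, and a prime cycle of length \<open>k\<close> has
  \<open>k\<close> representatives, which cancels the factor \<open>1 / k\<close>.\<close>

lemma has_sum_log_det:
  assumes "(geodesic_term has_sum L) (closed_geodesics F)"
  shows "((\<lambda>p. log_det (SOME c. c \<in> p)) has_sum L) (prime_cycles F)"
proof -
  have "((\<lambda>(c, m). geodesic_term (concat (replicate m c))) has_sum L) (prime_geodesics F \<times> {0<..})"
    using assms by (subst (asm) has_sum_reindex_bij_betw[OF bij_betw_prime_powers, symmetric])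
      (simp add: split_def)
  then have "((\<lambda>c. log_det c / of_nat (length c)) has_sum L) (prime_geodesics F)"
  proof (rule has_sum_SigmaD)
    fix c assume "c \<in> prime_geodesics F"
    then have cg: "c \<in> closed_geodesics F" by (simp add: prime_geodesics_eq)
    then have c: "c \<noteq> []" "set c \<subseteq> dedges F" using closed_geodesic_words by auto
    have "((\<lambda>m. mtrace (loop c ^\<^sub>m m) / of_nat m / of_nat (length c)) has_sum
        log_det c / of_nat (length c)) {0<..}"
      using log_det(1)[OF cg] by (rule has_sum_divide_const)
    then show "((\<lambda>m. case (c, m) of (c, m) \<Rightarrow> geodesic_term (concat (replicate m c))) has_sum
        log_det c / of_nat (length c)) {0<..}"
      by (rule has_sum_cong[THEN iffD1, rotated])
        (simp add: geodesic_term_def loop_concat_replicate c)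
  qed
  then have "((\<lambda>(p, c). log_det c / of_nat (length c)) has_sum L) (SIGMA p:prime_cycles F. p)"
    by (subst (asm) has_sum_reindex_bij_betw[OF bij_betw_snd_prime_cycles, symmetric])
      (simp add: split_def)
  then show ?thesis
  proof (rule has_sum_SigmaD)
    fix p assume p: "p \<in> prime_cycles F"
    define c where "c = (SOME c. c \<in> p)"
    have "c \<in> p" using prime_cycle_neq_empty[OF p] unfolding c_def by (simp add: some_in_eq)
    then have c: "c \<in> prime_geodesics F" "p = range (\<lambda>n. rotate n c)"
      using prime_cycle_rotations[OF p] by auto
    then have card: "card p = length c" and "length c > 0"
      using card_rotations[of c] primitive_neq_Nil[of c] by (auto simp: prime_geodesics_eq)
    then have "finite p" by (intro card_ge_0_finite) simp
    have "log_det d / of_nat (length d) = log_det c / of_nat (length c)" if "d \<in> p" for d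
      using that c by (auto simp: log_det_rotate prime_geodesics_eq)
    then have "(\<Sum>d\<in>p. log_det d / of_nat (length d)) = log_det c"
      using \<open>length c > 0\<close> by (simp add: card)
    with \<open>finite p\<close> show "((\<lambda>d. case (p, d) of (p, d) \<Rightarrow> log_det d / of_nat (length d)) has_sum
        log_det (SOME c. c \<in> p)) p"
      by (intro has_sum_finiteI) (simp_all add: c_def)
  qed
qed

text \<open>A finite partial product is \<open>exp\<close> of a finite partial sum, and continuity
  of \<open>exp\<close> carries the limit over finite sets across. The determinant is nonzero
  because it is a value of \<open>exp\<close>.\<close>

lemma euler_product:
  shows "has_euler_product F r w
      (inverse (Determinant.det (1\<^sub>m (card (coords (dedges F) r)) - transfer)))"
    and "Determinant.det (1\<^sub>m (card (coords (dedges F) r)) - transfer) \<noteq> 0"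
proof -
  obtain L where L: "(geodesic_term has_sum L) (closed_geodesics F)"
    and det: "exp (- L) = Determinant.det (1\<^sub>m (card (coords (dedges F) r)) - transfer)"
    using has_sum_geodesic_term by blast
  have factor: "inverse (cycle_det r w p) = exp (log_det (SOME c. c \<in> p))"
    if p: "p \<in> prime_cycles F" for p
  proof -
    have "(SOME c. c \<in> p) \<in> p" using prime_cycle_neq_empty[OF p] by (simp add: some_in_eq)
    then have "(SOME c. c \<in> p) \<in> closed_geodesics F"
      using prime_cycle_rotations(1)[OF p] by (simp add: prime_geodesics_eq)
    from log_det(2)[OF this, symmetric] show ?thesis
      by (simp add: cycle_det_def Let_def exp_minus)
  qed
  have "((\<lambda>P. exp (\<Sum>p\<in>P. log_det (SOME c. c \<in> p))) \<longlongrightarrow> exp L) (finite_subsets_at_top (prime_cycles F))"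
    using has_sum_log_det[OF L] unfolding has_sum_def by (rule tendsto_exp)
  then have "((\<lambda>P. \<Prod>p\<in>P. inverse (cycle_det r w p)) \<longlongrightarrow> exp L) (finite_subsets_at_top (prime_cycles F))"
  proof (rule Lim_transform_eventually)
    show "\<forall>\<^sub>F P in finite_subsets_at_top (prime_cycles F).
        exp (\<Sum>p\<in>P. log_det (SOME c. c \<in> p)) = (\<Prod>p\<in>P. inverse (cycle_det r w p))"
      by (rule eventually_finite_subsets_at_top_weakI)
        (auto simp: exp_sum factor intro!: prod.cong)
  qed
  then show "has_euler_product F r w
      (inverse (Determinant.det (1\<^sub>m (card (coords (dedges F) r)) - transfer)))"
    by (simp add: has_euler_product_def exp_minus flip: det)
  show "Determinant.det (1\<^sub>m (card (coords (dedges F) r)) - transfer) \<noteq> 0"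
    by (simp flip: det)
qed

end

section \<open>Scaling to small weights and analytic continuation\<close>

context weighted_hypergraph
begin

lemma small_weights:
  obtains d where "d > 0" "\<And>s. norm s < d \<Longrightarrow>
    \<exists>b. small_weighted_hypergraph F r (\<lambda>e f. s \<cdot>\<^sub>m w e f) b"
proof -
  \<comment> \<open>A crude common bound: the total of the moduli of all entries of all
    weights.\<close>
  define K where "K = (\<Sum>e\<in>dedges F. \<Sum>f\<in>dedges F. \<Sum>a<r f. \<Sum>j<r e. norm (follows_weight w r e f $$ (a, j)))"
  define N where "N = real (card (dedges F))"
  have K: "row_bounded K (follows_weight w r e f)" if "e \<in> dedges F" "f \<in> dedges F" for e f
    unfolding row_bounded_def
  proof (intro allI impI)
    fix a assume "a < dim_row (follows_weight w r e f)"
    then have a: "a < r f" using weight_carrier[OF that] by simp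
    have "(\<Sum>j<r e. norm (follows_weight w r e f $$ (a, j))) \<le>
        (\<Sum>a<r f. \<Sum>j<r e. norm (follows_weight w r e f $$ (a, j)))"
      using a by (intro member_le_sum) (auto intro: sum_nonneg)
    also have "\<dots> \<le> (\<Sum>f\<in>dedges F. \<Sum>a<r f. \<Sum>j<r e. norm (follows_weight w r e f $$ (a, j)))"
      using that finite_dedges by (intro member_le_sum) (auto intro!: sum_nonneg)
    also have "\<dots> \<le> K"
      unfolding K_def using that finite_dedges by (intro member_le_sum) (auto intro!: sum_nonneg)
    finally show "(\<Sum>j<dim_col (follows_weight w r e f). norm (follows_weight w r e f $$ (a, j))) \<le> K"
      using weight_carrier[OF that] by simp
  qed
  have "K \<ge> 0" unfolding K_def by (intro sum_nonneg) auto
  have "N \<ge> 0" by (simp add: N_def)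
  show ?thesis
  proof (rule that)
    \<comment> \<open>This radius forces both \<open>norm s * K\<close> and
      \<open>N * (norm s * K)\<close> below 1; the added ones keep the denominator positive when
      there are no edges or all weights vanish.\<close>
    show "1 / ((N + 1) * (K + 1)) > 0"
      using \<open>K \<ge> 0\<close> \<open>N \<ge> 0\<close> by simp
    fix s :: complex assume s: "norm s < 1 / ((N + 1) * (K + 1))"
    have "(N + 1) * (K + 1) > 0" using \<open>K \<ge> 0\<close> \<open>N \<ge> 0\<close> by simp
    then have "norm s * (N + 1) * (K + 1) < 1"
      using s by (simp only: pos_less_divide_eq mult.assoc)
    moreover have "norm s * K \<le> norm s * (N + 1) * (K + 1)" "N * (norm s * K) \<le> norm s * (N + 1) * (K + 1)"
      using \<open>K \<ge> 0\<close> \<open>N \<ge> 0\<close> by (simp_all add: algebra_simps)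
    ultimately have lt: "norm s * K < 1" "N * (norm s * K) < 1" by linarith+
    have "row_bounded (norm s * K) (follows_weight (\<lambda>e f. s \<cdot>\<^sub>m w e f) r e f)"
      if "e \<in> dedges F" "f \<in> dedges F" for e f
      unfolding row_bounded_def
    proof (intro allI impI)
      have eq: "follows_weight (\<lambda>e f. s \<cdot>\<^sub>m w e f) r e f = s \<cdot>\<^sub>m follows_weight w r e f"
        by (auto simp: follows_weight_def)
      fix a assume "a < dim_row (follows_weight (\<lambda>e f. s \<cdot>\<^sub>m w e f) r e f)"
      then have "(\<Sum>j<r e. norm (follows_weight w r e f $$ (a, j))) \<le> K" "a < r f"
        using K[OF that] weight_carrier[OF that] by (auto simp: row_bounded_def eq)
      then show "(\<Sum>j<dim_col (follows_weight (\<lambda>e f. s \<cdot>\<^sub>m w e f) r e f).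
          norm (follows_weight (\<lambda>e f. s \<cdot>\<^sub>m w e f) r e f $$ (a, j))) \<le> norm s * K"
        using weight_carrier[OF that]
        by (auto simp: eq norm_mult sum_distrib_left[symmetric] intro!: mult_left_mono)
    qed
    then have "small_weighted_hypergraph F r (\<lambda>e f. s \<cdot>\<^sub>m w e f) (norm s * K)"
      using finite_dedges follows_carrier \<open>K \<ge> 0\<close> lt unfolding N_def by unfold_locales auto
    then show "\<exists>b. small_weighted_hypergraph F r (\<lambda>e f. s \<cdot>\<^sub>m w e f) b" ..
  qed
qed

lemma transfer_smult:
  "weighted_digraph.transfer (dedges F) r (follows_weight (\<lambda>e f. s \<cdot>\<^sub>m w e f) r) = s \<cdot>\<^sub>m transfer"
proof -
  interpret s: weighted_hypergraph F r "\<lambda>e f. s \<cdot>\<^sub>m w e f"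
    using finite_dedges follows_carrier by unfold_locales auto
  have "follows_weight (\<lambda>e f. s \<cdot>\<^sub>m w e f) r e f $$ (a, j) = s * follows_weight w r e f $$ (a, j)"
    if "e \<in> dedges F" "f \<in> dedges F" "a < r f" "j < r e" for e f a j
    using that follows_carrier[of e f] by (auto simp: follows_weight_def)
  then show ?thesis
    unfolding s.transfer_def transfer_def mat_on_smult
    by (intro mat_on_cong) (auto simp: coords_def)
qed

theorem inverse_graph_zeta:
  "inverse (graph_zeta F r w) = Determinant.det (1\<^sub>m (card (coords (dedges F) r)) - transfer)"
proof -
  define n where "n = card (coords (dedges F) r)"
  define g where "g s = Determinant.det (1\<^sub>m n - s \<cdot>\<^sub>m transfer)" for s :: complex
  define good where "good h \<longleftrightarrow> h holomorphic_on UNIV \<and> (\<exists>\<delta>>0. \<forall>s. norm s < \<delta> \<longrightarrow> h s \<noteq> 0 \<and>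
      has_euler_product F r (\<lambda>e e'. s \<cdot>\<^sub>m w e e') (inverse (h s)))" for h
  have transfer: "transfer \<in> carrier_mat n n" unfolding n_def by (rule transfer_carrier)
  have "good g"
    unfolding good_def
  proof
    \<comment> \<open>The triangular form exhibits \<open>g\<close> as a polynomial in
      \<open>s\<close>, hence as entire.\<close>
    obtain B P Q where "similar_mat_wit transfer B P Q" "upper_triangular B"
      using triangularize[OF transfer] by metis
    from det_one_minus_smult_triangularized[OF transfer this]
    have "g = (\<lambda>s. \<Prod>i<n. 1 - s * B $$ (i, i))" by (simp add: g_def fun_eq_iff)
    then show "g holomorphic_on UNIV" by (auto intro!: holomorphic_intros)
    obtain \<delta> where "\<delta> > 0" and \<delta>: "\<And>s. norm s < \<delta> \<Longrightarrow>
        \<exists>b. small_weighted_hypergraph F r (\<lambda>e f. s \<cdot>\<^sub>m w e f) b"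
      using small_weights by metis
    have "g s \<noteq> 0 \<and> has_euler_product F r (\<lambda>e e'. s \<cdot>\<^sub>m w e e') (inverse (g s))" if "norm s < \<delta>" for s
    proof -
      obtain b where "small_weighted_hypergraph F r (\<lambda>e f. s \<cdot>\<^sub>m w e f) b"
        using \<delta>[OF \<open>norm s < \<delta>\<close>] by blast
      from small_weighted_hypergraph.euler_product[OF this] show ?thesis
        by (simp add: g_def n_def transfer_smult)
    qed
    with \<open>\<delta> > 0\<close> show "\<exists>\<delta>>0. \<forall>s. norm s < \<delta> \<longrightarrow> g s \<noteq> 0 \<and>
        has_euler_product F r (\<lambda>e e'. s \<cdot>\<^sub>m w e e') (inverse (g s))" by blast
  qed
  have unique: "h 1 = g 1" if "good h" for h
  proof -
    obtain \<delta> where \<delta>: "\<delta> > 0" "\<And>s. norm s < \<delta> \<Longrightarrow>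
        has_euler_product F r (\<lambda>e e'. s \<cdot>\<^sub>m w e e') (inverse (h s))"
      using \<open>good h\<close> unfolding good_def by blast
    obtain \<delta>' where \<delta>': "\<delta>' > 0" "\<And>s. norm s < \<delta>' \<Longrightarrow>
        has_euler_product F r (\<lambda>e e'. s \<cdot>\<^sub>m w e e') (inverse (g s))"
      using \<open>good g\<close> unfolding good_def by blast
    have eq: "h s = g s" if "s \<in> ball 0 (min \<delta> \<delta>')" for s
    proof -
      \<comment> \<open>Both are limits of the same partial products along a nontrivial
        filter.\<close>
      have "inverse (h s) = inverse (g s)"
        using \<delta>(2)[of s] \<delta>'(2)[of s] that unfolding has_euler_product_def
        by (intro tendsto_unique[OF finite_subsets_at_top_neq_bot]) auto
      then show ?thesis by simp
    qed
    show ?thesis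
      by (rule analytic_continuation_open[of "ball 0 (min \<delta> \<delta>')" UNIV h g])
        (use \<delta>(1) \<delta>'(1) eq \<open>good h\<close> \<open>good g\<close> in \<open>auto simp: good_def\<close>)
  qed
  have "(THE z. \<exists>h. h holomorphic_on UNIV \<and> (\<exists>\<delta>>0. \<forall>s. norm s < \<delta> \<longrightarrow> h s \<noteq> 0 \<and>
      has_euler_product F r (\<lambda>e e'. s \<cdot>\<^sub>m w e e') (inverse (h s))) \<and> z = h 1) = g 1"
    using \<open>good g\<close> unique unfolding good_def by (intro the_equality) blast+
  \<comment> \<open>Inverting twice returns \<open>g 1\<close> also when it is 0, by the convention
    for the inverse of 0.\<close>
  then show ?thesis
    by (simp add: graph_zeta_def g_def n_def one_smult_mat)
qed

end

section \<open>The determinant formula\<close>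

lemma mat_on_eq_iff:
  assumes "finite I"
  shows "mat_on I A = mat_on I B \<longleftrightarrow> (\<forall>x\<in>I. \<forall>y\<in>I. A x y = B x y)"
proof
  assume eq: "mat_on I A = mat_on I B"
  show "\<forall>x\<in>I. \<forall>y\<in>I. A x y = B x y"
  proof (intro ballI)
    fix x y assume "x \<in> I" "y \<in> I"
    moreover have "I = from_nat_into I ` {..<card I}"
      using bij_betw_from_nat_into_finite[OF assms] by (simp add: bij_betw_def)
    ultimately obtain k l where
      "k < card I" "x = from_nat_into I k" "l < card I" "y = from_nat_into I l"
      by blast
    then show "A x y = B x y"
      using arg_cong[OF eq, of "\<lambda>M. M $$ (k, l)"] by (simp add: mat_on_def)
  qed
qed (auto intro: mat_on_cong)

lemma det_mat_on_one_minus_commute: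
  assumes "finite I" "finite J"
  shows "Determinant.det (mat_on I (\<lambda>x y. (if x = y then 1 else 0) - (\<Sum>v\<in>J. P x v * Q v y))) =
    Determinant.det (mat_on J (\<lambda>x y. (if x = y then 1 else 0) - (\<Sum>v\<in>I. Q x v * P v y)))"
  using det_one_minus_mult_commute[of "rmat_on I J P" "card I" "card J" "rmat_on J I Q"] assms
  by (simp add: rmat_on_mult mat_on_minus flip: mat_on_one mat_on_eq_rmat_on)

lemma sum_delta_coords:
  fixes r :: "'x \<Rightarrow> nat"
  assumes "finite X"
  shows "(\<Sum>j\<in>X. \<Sum>b<r j. if j = k \<and> b = c then f j b else 0) =
    (if k \<in> X \<and> c < r k then f k c else 0)"
proof -
  have "(\<Sum>j\<in>X. \<Sum>b<r j. if j = k \<and> b = c then f j b else 0) =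
      (\<Sum>j\<in>X. if j = k then (if c < r k then f k c else 0) else 0)"
    by (intro sum.cong refl) (auto simp: sum.delta)
  also have "\<dots> = (if k \<in> X \<and> c < r k then f k c else 0)"
    using assms by (simp add: sum.delta)
  finally show ?thesis .
qed

section \<open>Factoring the edge matrix through the vertices\<close>

locale hypergraph_weights =
  fixes V :: "'v set" and F :: "'v set set" and r :: "'v \<Rightarrow> nat"
    and u w :: "'v set \<Rightarrow> 'v \<Rightarrow> 'v \<Rightarrow> complex mat"
  assumes hypergraph: "hypergraph V F"
    and u_carrier: "\<alpha> \<in> F \<Longrightarrow> i \<in> \<alpha> \<Longrightarrow> j \<in> \<alpha> \<Longrightarrow> i \<noteq> j \<Longrightarrow> u \<alpha> i j \<in> carrier_mat (r j) (r i)"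
    and U_W_inverse: "\<alpha> \<in> F \<Longrightarrow> inverts_mat (U_mat r u \<alpha>) (W_mat r w \<alpha>)"
begin

definition U_block :: "'v set \<Rightarrow> 'v \<Rightarrow> 'v \<Rightarrow> complex mat" where
  "U_block \<alpha> i j = (if i = j then 1\<^sub>m (r i) else u \<alpha> j i)"

definition edge_coords :: "('v dedge \<times> nat) set" where
  "edge_coords = coords (dedges F) (\<lambda>e. r (edge_target e))"

definition U_entry :: "'v dedge \<times> nat \<Rightarrow> 'v dedge \<times> nat \<Rightarrow> complex" where
  "U_entry = (\<lambda>((\<alpha>, i), a) ((\<beta>, j), b). if \<alpha> = \<beta> then U_block \<alpha> i j $$ (a, b) else 0)"

lemma finite_V: "finite V" and finite_F: "finite F" and factor_subset: "\<alpha> \<in> F \<Longrightarrow> \<alpha> \<subseteq> V"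
  using hypergraph by (auto simp: hypergraph_def)

lemma finite_factor: "\<alpha> \<in> F \<Longrightarrow> finite \<alpha>"
  using factor_subset finite_V finite_subset by blast

lemma finite_dedges: "finite (dedges F)"
  by (simp add: dedges_def finite_F finite_factor)

sublocale weighted_hypergraph F "\<lambda>e. r (edge_target e)" "edge_weights u"
proof unfold_locales
  show "finite (dedges F)" by (rule finite_dedges)
qed (auto simp: dedges_def follows_def edge_weights_def intro!: u_carrier)

lemma sum_edge_coords:
  "(\<Sum>x\<in>edge_coords. f x) = (\<Sum>\<alpha>\<in>F. \<Sum>i\<in>\<alpha>. \<Sum>a<r i. f ((\<alpha>, i), a))"
proof -
  have "(\<Sum>x\<in>edge_coords. f x) = (\<Sum>e\<in>dedges F. \<Sum>a<r (edge_target e). f (e, a))"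
    unfolding edge_coords_def by (rule sum_coords[OF finite_dedges])
  also have "\<dots> = (\<Sum>(\<alpha>, i)\<in>(SIGMA \<alpha>:F. \<alpha>). \<Sum>a<r i. f ((\<alpha>, i), a))"
    by (simp add: dedges_def split_def)
  also have "\<dots> = (\<Sum>\<alpha>\<in>F. \<Sum>i\<in>\<alpha>. \<Sum>a<r i. f ((\<alpha>, i), a))"
    by (rule sum.Sigma[symmetric]) (auto simp: finite_F finite_factor)
  finally show ?thesis .
qed

lemma U_W_entries:
  assumes \<alpha>: "\<alpha> \<in> F" and "i \<in> \<alpha>" "k \<in> \<alpha>" "a < r i" "c < r k"
  shows "(\<Sum>j\<in>\<alpha>. \<Sum>b<r j. U_block \<alpha> i j $$ (a, b) * w \<alpha> k j $$ (b, c)) =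
    (if i = k \<and> a = c then 1 else 0)"
proof -
  define I where "I = coords \<alpha> r"
  have fin: "finite I" by (simp add: I_def finite_coords finite_factor \<alpha>)
  have U: "U_mat r u \<alpha> = mat_on I (\<lambda>(i, a) (j, b). U_block \<alpha> i j $$ (a, b))"
    by (simp add: U_mat_def block_mat_def I_def U_block_def)
  have "U_mat r u \<alpha> * W_mat r w \<alpha> = 1\<^sub>m (card I)"
    using U_W_inverse[OF \<alpha>] by (simp add: inverts_mat_def U)
  then have "mat_on I (\<lambda>(i, a) (k, c). \<Sum>(j, b)\<in>I. U_block \<alpha> i j $$ (a, b) * w \<alpha> k j $$ (b, c)) =
      mat_on I (\<lambda>x y. if x = y then 1 else 0)"
    by (simp add: U W_mat_def block_mat_def mat_on_one fin mat_on_mult flip: I_def)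
      (simp add: split_def)
  then have "(\<Sum>(j, b)\<in>I. U_block \<alpha> i j $$ (a, b) * w \<alpha> k j $$ (b, c)) =
      (if i = k \<and> a = c then 1 else 0)"
    using assms unfolding mat_on_eq_iff[OF fin] by (force simp: I_def coords_def)
  then show ?thesis by (simp add: I_def sum_coords finite_factor \<alpha>)
qed

text \<open>The matrix of \<open>(I - U\<^sup>-\<^sup>1) S\<^sup>T\<close>, where \<open>S\<close> sums a function on edges over the edges into
  a given vertex.\<close>

definition P_entry :: "'v dedge \<times> nat \<Rightarrow> 'v \<times> nat \<Rightarrow> complex" where
  "P_entry = (\<lambda>((\<alpha>, i), a) (j, b).
     (if i = j \<and> a = b then 1 else 0) - (if j \<in> \<alpha> then w \<alpha> j i $$ (a, b) else 0))"

definition S_entry :: "'v \<times> nat \<Rightarrow> 'v dedge \<times> nat \<Rightarrow> complex" where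
  "S_entry = (\<lambda>(i, a) ((\<alpha>, j), b). if i = j \<and> a = b then 1 else 0)"

text \<open>Every column of \<open>S\<close> has a single entry 1, at the target of the edge, so
  \<open>P S\<close> repeats a column of \<open>P\<close> for each edge into that vertex.\<close>

lemma sum_P_S:
  assumes "y \<in> edge_coords"
  shows "(\<Sum>v\<in>coords V r. P_entry x v * S_entry v y) = P_entry x (edge_target (fst y), snd y)"
proof -
  obtain \<gamma> k c where y: "y = ((\<gamma>, k), c)" "\<gamma> \<in> F" "k \<in> \<gamma>" "c < r k"
    using assms by (auto simp: edge_coords_def coords_def dedges_def)
  have "(\<Sum>v\<in>coords V r. P_entry x v * S_entry v y) =
      (\<Sum>j\<in>V. \<Sum>b<r j. if j = k \<and> b = c then P_entry x (j, b) else 0)"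
    by (auto simp: sum_coords finite_V y S_entry_def intro!: sum.cong)
  also have "\<dots> = P_entry x (k, c)"
    using y factor_subset by (subst sum_delta_coords[OF finite_V]) auto
  finally show ?thesis by (simp add: y)
qed

text \<open>These are the entries of \<open>(U - I) S^T\<close>: multiplying by \<open>U\<close>
  turns the inverse block into the identity, so \<open>w\<close> disappears from the result.\<close>

lemma sum_U_P:
  assumes "\<alpha> \<in> F" "i \<in> \<alpha>" "a < r i" "c < r k"
  shows "(\<Sum>z\<in>edge_coords. U_entry ((\<alpha>, i), a) z * P_entry z (k, c)) =
    (if k \<in> \<alpha> then U_block \<alpha> i k $$ (a, c) - (if i = k \<and> a = c then 1 else 0) else 0)"
proof -
  have "(\<Sum>z\<in>edge_coords. U_entry ((\<alpha>, i), a) z * P_entry z (k, c)) =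
      (\<Sum>\<beta>\<in>F. if \<beta> = \<alpha> then \<Sum>j\<in>\<alpha>. \<Sum>b<r j. U_block \<alpha> i j $$ (a, b) * P_entry ((\<alpha>, j), b) (k, c) else 0)"
    unfolding sum_edge_coords by (intro sum.cong) (auto simp: U_entry_def)
  also have "\<dots> = (\<Sum>j\<in>\<alpha>. \<Sum>b<r j. U_block \<alpha> i j $$ (a, b) * P_entry ((\<alpha>, j), b) (k, c))"
    using assms by (simp add: finite_F)
  also have "\<dots> = (\<Sum>j\<in>\<alpha>. \<Sum>b<r j. if j = k \<and> b = c then U_block \<alpha> i j $$ (a, b) else 0) -
      (if k \<in> \<alpha> then \<Sum>j\<in>\<alpha>. \<Sum>b<r j. U_block \<alpha> i j $$ (a, b) * w \<alpha> k j $$ (b, c) else 0)"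
    by (auto simp: P_entry_def right_diff_distrib sum_subtractf intro!: sum.cong arg_cong2[of _ _ _ _ "(-)"])
  also have "\<dots> = (if k \<in> \<alpha> then U_block \<alpha> i k $$ (a, c) - (if i = k \<and> a = c then 1 else 0) else 0)"
    using assms by (simp add: U_W_entries sum_delta_coords finite_factor)
  finally show ?thesis .
qed

text \<open>The product has the entries of \<open>U - (U - I) S^T S\<close>. For two edges of one
  factor the \<open>U\<close> terms cancel and leave the identity. For different factors the first
  term is 0, and the second is minus the block \<open>u\<close>, which is absent if the targets
  agree.\<close>

lemma one_minus_transfer:
  "1\<^sub>m (card edge_coords) - transfer = mat_on edge_coords U_entry *
    mat_on edge_coords (\<lambda>x y. (if x = y then 1 else 0) - (\<Sum>v\<in>coords V r. P_entry x v * S_entry v y))"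
proof -
  let ?A = "follows_weight (edge_weights u) (\<lambda>e. r (edge_target e))"
  have fin: "finite edge_coords" unfolding edge_coords_def by (rule finite_coords[OF finite_dedges])
  have "(if x = y then 1 else 0) - (case x of (f, a) \<Rightarrow> \<lambda>(e, b). ?A e f $$ (a, b)) y =
      (\<Sum>z\<in>edge_coords. U_entry x z *
        ((if z = y then 1 else 0) - (\<Sum>v\<in>coords V r. P_entry z v * S_entry v y)))"
    if x: "x \<in> edge_coords" and y: "y \<in> edge_coords" for x y
  proof -
    obtain \<alpha> i a where x': "x = ((\<alpha>, i), a)" "\<alpha> \<in> F" "i \<in> \<alpha>" "a < r i"
      using x by (auto simp: edge_coords_def coords_def dedges_def)
    obtain \<gamma> k c where y': "y = ((\<gamma>, k), c)" "\<gamma> \<in> F" "k \<in> \<gamma>" "c < r k"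
      using y by (auto simp: edge_coords_def coords_def dedges_def)
    have "(\<Sum>z\<in>edge_coords. U_entry x z *
        ((if z = y then 1 else 0) - (\<Sum>v\<in>coords V r. P_entry z v * S_entry v y))) =
        (\<Sum>z\<in>edge_coords. if z = y then U_entry x z else 0) -
        (\<Sum>z\<in>edge_coords. U_entry x z * P_entry z (k, c))"
      unfolding sum_P_S[OF y] sum_subtractf[symmetric]
      by (intro sum.cong) (auto simp: y' right_diff_distrib)
    also have "\<dots> = U_entry x y -
        (if k \<in> \<alpha> then U_block \<alpha> i k $$ (a, c) - (if i = k \<and> a = c then 1 else 0) else 0)"
      using x' y y' fin by (simp add: sum_U_P)
    also have "\<dots> = (if x = y then 1 else 0) - ?A (\<gamma>, k) (\<alpha>, i) $$ (a, c)"
      using x' y' by (auto simp: U_entry_def U_block_def follows_weight_def follows_def edge_weights_def)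
    finally show ?thesis by (simp add: x' y')
  qed
  then show ?thesis
    unfolding mat_on_mult[OF fin] mat_on_one[OF fin, symmetric] transfer_def edge_coords_def[symmetric]
      mat_on_minus
    by (intro mat_on_cong) auto
qed

text \<open>Stated for a set of factors so that induction can split off one at a time: no entry
  links edges of different factors. What remains is to rename the edges of a factor as its
  vertices.\<close>

lemma det_U_entry_subset:
  assumes "finite G" "G \<subseteq> F"
  shows "Determinant.det (mat_on (coords (dedges G) (\<lambda>e. r (edge_target e))) U_entry) =
    (\<Prod>\<alpha>\<in>G. Determinant.det (U_mat r u \<alpha>))"
  using assms
proof (induction G rule: finite_induct)
  case empty
  then show ?case by (simp add: dedges_def coords_def mat_on_def)
next
  case (insert \<alpha> G)
  let ?I = "coords ({\<alpha>} \<times> \<alpha>) (\<lambda>e. r (edge_target e))"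
  let ?J = "coords (dedges G) (\<lambda>e. r (edge_target e))"
  have \<alpha>: "\<alpha> \<in> F" using insert.prems by simp
  have "finite (dedges G)"
    using insert.prems finite_factor \<open>finite G\<close> by (auto simp: dedges_def intro: finite_SigmaI)
  then have fin: "finite ?I" "finite ?J" by (auto intro!: finite_coords simp: finite_factor \<alpha>)
  have Un: "coords (dedges (insert \<alpha> G)) (\<lambda>e. r (edge_target e)) = ?I \<union> ?J"
    by (auto simp: coords_def dedges_def)
  have disj: "?I \<inter> ?J = {}" using insert.hyps by (auto simp: coords_def dedges_def)
  have "U_entry x y = 0" if "x \<in> ?I" "y \<in> ?J" for x y
    using that insert.hyps by (auto simp: coords_def dedges_def U_entry_def)
  from det_mat_on_Un[OF fin disj this]
  have "Determinant.det (mat_on (?I \<union> ?J) U_entry) =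
      Determinant.det (mat_on ?I U_entry) * Determinant.det (mat_on ?J U_entry)" .
  also have "Determinant.det (mat_on ?I U_entry) = Determinant.det (U_mat r u \<alpha>)"
  proof -
    have "bij_betw (\<lambda>(i, a). ((\<alpha>, i), a)) (coords \<alpha> r) ?I"
      by (rule bij_betw_byWitness[of _ "\<lambda>((\<alpha>, i), a). (i, a)"]) (auto simp: coords_def)
    from det_mat_on_reindex[OF finite_coords[OF finite_factor[OF \<alpha>]] this, of U_entry]
    show ?thesis
      by (simp add: U_mat_def block_mat_def U_entry_def U_block_def split_def)
  qed
  finally show ?case using insert by (simp add: Un)
qed

lemma det_S_P:
  "Determinant.det (mat_on (coords V r)
     (\<lambda>x y. (if x = y then 1 else 0) - (\<Sum>v\<in>edge_coords. S_entry x v * P_entry v y))) =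
   op_det (coords V r) (\<lambda>g x. g x - D_op F g x + W_op F r w g x)"
  unfolding op_det_def
proof (rule arg_cong[of _ _ Determinant.det], rule mat_on_cong)
  fix x y assume "x \<in> coords V r" "y \<in> coords V r"
  then obtain i a k c where x: "x = (i, a)" "i \<in> V" "a < r i" and y: "y = (k, c)" "k \<in> V" "c < r k"
    by (auto simp: coords_def)
  let ?\<delta> = "if x = y then 1 else 0 :: complex"
  let ?W = "\<Sum>\<alpha> | \<alpha> \<in> F \<and> i \<in> \<alpha>. if k \<in> \<alpha> then w \<alpha> k i $$ (a, c) else 0"
  have "(\<Sum>v\<in>edge_coords. S_entry x v * P_entry v y) =
      (\<Sum>\<alpha>\<in>F. \<Sum>j\<in>\<alpha>. \<Sum>b<r j. if j = i \<and> b = a then P_entry ((\<alpha>, j), b) y else 0)"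
    unfolding sum_edge_coords by (intro sum.cong refl) (auto simp: S_entry_def x)
  also have "\<dots> = (\<Sum>\<alpha>\<in>F. if i \<in> \<alpha> then P_entry ((\<alpha>, i), a) y else 0)"
    using x by (intro sum.cong refl, subst sum_delta_coords) (auto simp: finite_factor)
  also have "\<dots> = (\<Sum>\<alpha> | \<alpha> \<in> F \<and> i \<in> \<alpha>. P_entry ((\<alpha>, i), a) y)"
    by (simp add: sum.inter_filter finite_F)
  \<comment> \<open>Every factor containing \<open>i\<close> contributes one copy of the unit entry,
    which is how the degree arises.\<close>
  also have "\<dots> = of_nat (vertex_degree F i) * ?\<delta> - ?W"
    by (simp add: P_entry_def x y sum_subtractf vertex_degree_def)
  finally have SP: "(\<Sum>v\<in>edge_coords. S_entry x v * P_entry v y) =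
      of_nat (vertex_degree F i) * ?\<delta> - ?W" .
  have "W_op F r w (\<lambda>z. if z = y then 1 else 0) x =
      (\<Sum>\<alpha> | \<alpha> \<in> F \<and> i \<in> \<alpha>. \<Sum>j\<in>\<alpha>. \<Sum>b<r j. if j = k \<and> b = c then w \<alpha> j i $$ (a, b) else 0)"
    by (auto simp: W_op_def x y intro!: sum.cong)
  also have "\<dots> = ?W"
    using y by (intro sum.cong refl, subst sum_delta_coords) (auto simp: finite_factor)
  finally show "?\<delta> - (\<Sum>v\<in>edge_coords. S_entry x v * P_entry v y) =
      ?\<delta> - D_op F (\<lambda>z. if z = y then 1 else 0) x + W_op F r w (\<lambda>z. if z = y then 1 else 0) x"
    unfolding SP by (simp add: D_op_def x)
qed

lemma determinant_formula:
  "Determinant.det (1\<^sub>m (card edge_coords) - transfer) =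
    op_det (coords V r) (\<lambda>g x. g x - D_op F g x + W_op F r w g x) *
    (\<Prod>\<alpha>\<in>F. Determinant.det (U_mat r u \<alpha>))"
proof -
  have fin: "finite edge_coords" unfolding edge_coords_def by (rule finite_coords[OF finite_dedges])
  have "Determinant.det (mat_on edge_coords U_entry) = (\<Prod>\<alpha>\<in>F. Determinant.det (U_mat r u \<alpha>))"
    using det_U_entry_subset[OF finite_F] by (simp add: edge_coords_def)
  then show ?thesis
    unfolding one_minus_transfer det_mult[OF mat_on_carrier mat_on_carrier]
      det_mat_on_one_minus_commute[OF fin finite_coords[OF finite_V]] det_S_P
    by simp
qed

end

theorem theorem3p2:
  fixes V :: "'v set" and F :: "'v set set" and r :: "'v \<Rightarrow> nat"
    and u w :: "'v set \<Rightarrow> 'v \<Rightarrow> 'v \<Rightarrow> complex mat"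
  assumes "hypergraph V F"
    and "\<And>i. i \<in> V \<Longrightarrow> r i > 0"
    and "\<And>\<alpha> i j. \<alpha> \<in> F \<Longrightarrow> i \<in> \<alpha> \<Longrightarrow> j \<in> \<alpha> \<Longrightarrow> i \<noteq> j \<Longrightarrow> u \<alpha> i j \<in> carrier_mat (r j) (r i)"
    and "\<And>\<alpha>. \<alpha> \<in> F \<Longrightarrow> invertible_mat (U_mat r u \<alpha>)"
    and "\<And>\<alpha> i j. \<alpha> \<in> F \<Longrightarrow> i \<in> \<alpha> \<Longrightarrow> j \<in> \<alpha> \<Longrightarrow> w \<alpha> i j \<in> carrier_mat (r j) (r i)"
    and "\<And>\<alpha>. \<alpha> \<in> F \<Longrightarrow> inverts_mat (U_mat r u \<alpha>) (W_mat r w \<alpha>)"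
    and "\<And>\<alpha>. \<alpha> \<in> F \<Longrightarrow> inverts_mat (W_mat r w \<alpha>) (U_mat r u \<alpha>)"
  shows "inverse (graph_zeta F (\<lambda>e. r (edge_target e)) (edge_weights u)) =
    op_det (coords V r) (\<lambda>g x. g x - D_op F g x + W_op F r w g x) *
    (\<Prod>\<alpha>\<in>F. Determinant.det (U_mat r u \<alpha>))"
proof -
  interpret hypergraph_weights V F r u w
    using assms(1,3,6) by unfold_locales auto
  show ?thesis
    using inverse_graph_zeta determinant_formula by (simp add: edge_coords_def)
qed

end
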